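(* Let $X$ be a Banach space, $c\in\mathbb N$, $1\le p\le\infty$, and let $g$ be a weight on $\mathbb Z^c$ satisfying conditions (a)–(e) below. Then the subalgebra $\widetilde{\mathfrak s_{1,g}}\bigl(\mathbb Z^c,\mathfrak S_1(X)\bigr)$ is full (inverse-closed) in the algebra $\mathcal B\bigl(l_p(\mathbb Z^c,X)\bigr)$. In particular, if $T\in\mathfrak s_{1,g}\bigl(\mathbb Z^c,\mathfrak S_1(X)\bigr)$, $\lambda\in\mathbb C$, and $\lambda\mathbf 1+T$ is invertible in $\mathcal B\bigl(l_p(\mathbb Z^c,X)\bigr)$, then (for $X$ infinite-dimensional) $\lambda\ne0$ and $(\lambda\mathbf 1+T)^{-1}=\frac1\lambda\mathbf 1+T_1$ with $T_1\in\mathfrak s_{1,g}\bigl(\mathbb Z^c,\mathfrak S_1(X)\bigr)$.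
   Context: A weight on $\mathbb Z^c$ is a function $g:\mathbb Z^c\to(0,\infty)$; here it is assumed to satisfy: (a) $g(0)=1$; (b) $g(m+n)\le g(m)g(n)$; (c) $g(-n)=g(n)$; (d) $g(n)\ge1$; (e) for every $t\in\mathbb Z^c$, $\lim_{n\to\infty,\,n\in\mathbb Z}\sqrt[n]{g(nt)}=1$ (equivalently $\ln g(nt)/n\to0$). $l_{1,g}(\mathbb Z^c,\mathbb C)$ is the space of families $\beta=\{\beta_m\}_{m\in\mathbb Z^c}$ with $\sum_m g(m)|\beta_m|<\infty$. $l_p(\mathbb Z^c,X)$ is the usual Banach space of $X$-valued families with $\ell^p$ norm ($\sup$ norm for $p=\infty$). A bounded operator $A$ on $X$ is nuclear if $Ax=\sum_{i\ge1}a_i(x)y_i$ with $a_i\in X^*$, $y_i\in X$, $\sum_i\|a_i\|\|y_i\|<\infty$; $\mathfrak S_1(X)$ denotes the nuclear operators, with nuclear norm $\|A\|_{\mathfrak S_1}=\inf\sum_i\|a_i\|\|y_i\|$ over all such representations. $\mathfrak s_{1,g}\bigl(\mathbb Z^c,\mathfrak S_1(X)\bigr)$ ("locally nuclear operators") is the set of operators $T\in\mathcal B(l_p(\mathbb Z^c,X))$ of the form $(Tx)_k=\sum_{m\in\mathbb Z^c}b_{km}x_{k-m}$, $k\in\mathbb Z^c$, where $b_{km}\in\mathfrak S_1(X)$ and $\|b_{km}\|_{\mathfrak S_1}\le\beta_m$ for all $k,m$, for some nonnegative $\beta\in l_{1,g}(\mathbb Z^c,\mathbb C)$. $\widetilde{\mathfrak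 s_{1,g}}\bigl(\mathbb Z^c,\mathfrak S_1(X)\bigr)$ denotes $\{\lambda\mathbf 1+T:\lambda\in\mathbb C,\ T\in\mathfrak s_{1,g}(\mathbb Z^c,\mathfrak S_1(X))\}$ if $X$ is infinite-dimensional, and $\mathfrak s_{1,g}(\mathbb Z^c,\mathfrak S_1(X))$ itself if $X$ is finite-dimensional. A unital subalgebra $\mathcal R$ of a unital algebra $\mathcal B$ is full (inverse-closed) if every $B\in\mathcal R$ invertible in $\mathcal B$ has its inverse in $\mathcal R$. *)

theory Defs
  imports "HOL-Analysis.Analysis"
begin

text \<open>A complex Banach space is a real Banach space (type class banach) together with
  an operator J (multiplication by the imaginary unit) such that the resulting complex
  scalar multiplication is homogeneous for the norm.\<close>

definition cscale :: "('a::real_vector \<Rightarrow> 'a) \<Rightarrow> complex \<Rightarrow> 'a \<Rightarrow> 'a" where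
  "cscale J z x = Re z *\<^sub>R x + Im z *\<^sub>R J x"

definition complex_banach :: "('a::banach \<Rightarrow> 'a) \<Rightarrow> bool" where
  "complex_banach J \<longleftrightarrow> linear J \<and> (\<forall>x. J (J x) = - x) \<and>
     (\<forall>z x. norm (cscale J z x) = cmod z * norm x)"

definition clin :: "('a::real_vector \<Rightarrow> 'a) \<Rightarrow> ('b::real_vector \<Rightarrow> 'b) \<Rightarrow> ('a \<Rightarrow> 'b) \<Rightarrow> bool" where
  "clin J1 J2 f \<longleftrightarrow> linear f \<and> (\<forall>x. f (J1 x) = J2 (f x))"

definition cdual :: "('a::real_normed_vector \<Rightarrow> 'a) \<Rightarrow> ('a \<Rightarrow> complex) \<Rightarrow> bool" where
  "cdual J a \<longleftrightarrow> bounded_linear a \<and> clin J (\<lambda>z. \<i> * z) a"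

definition cfindim :: "('a::real_vector \<Rightarrow> 'a) \<Rightarrow> bool" where
  "cfindim J \<longleftrightarrow> (\<exists>B. finite B \<and> (\<forall>x. \<exists>c. x = (\<Sum>b\<in>B. cscale J (c b) b)))"

definition nuc_rep :: "('a::banach \<Rightarrow> 'a) \<Rightarrow> ('a \<Rightarrow> 'a) \<Rightarrow> (nat \<Rightarrow> 'a \<Rightarrow> complex) \<Rightarrow> (nat \<Rightarrow> 'a) \<Rightarrow> bool" where
  "nuc_rep J A a y \<longleftrightarrow> (\<forall>i. cdual J (a i)) \<and> summable (\<lambda>i. onorm (a i) * norm (y i)) \<and>
     (\<forall>x. (\<lambda>i. cscale J (a i x) (y i)) sums (A x))"

definition nuclear :: "('a::banach \<Rightarrow> 'a) \<Rightarrow> ('a \<Rightarrow> 'a) \<Rightarrow> bool" where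
  "nuclear J A \<longleftrightarrow> bounded_linear A \<and> clin J J A \<and> (\<exists>a y. nuc_rep J A a y)"

definition nuclear_norm :: "('a::banach \<Rightarrow> 'a) \<Rightarrow> ('a \<Rightarrow> 'a) \<Rightarrow> real" where
  "nuclear_norm J A = Inf {(\<Sum>i. onorm (a i) * norm (y i)) | a y. nuc_rep J A a y}"

definition weight :: "(int ^ 'c::finite \<Rightarrow> real) \<Rightarrow> bool" where
  "weight g \<longleftrightarrow> (\<forall>n. g n > 0) \<and> g 0 = 1 \<and> (\<forall>m n. g (m + n) \<le> g m * g n) \<and>
     (\<forall>n. g (- n) = g n) \<and> (\<forall>n. g n \<ge> 1) \<and>
     (\<forall>t. (\<lambda>n::nat. root n (g (int n *s t))) \<longlonglongrightarrow> 1)"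

definition l1g :: "(int ^ 'c::finite \<Rightarrow> real) \<Rightarrow> (int ^ 'c \<Rightarrow> real) \<Rightarrow> bool" where
  "l1g g \<beta> \<longleftrightarrow> (\<lambda>m. g m * norm (\<beta> m)) summable_on UNIV"

definition lp :: "ereal \<Rightarrow> (int ^ 'c::finite \<Rightarrow> 'a::real_normed_vector) set" where
  "lp p = {x. if p = \<infinity> then bounded (range (\<lambda>k. norm (x k)))
              else (\<lambda>k. norm (x k) powr real_of_ereal p) summable_on UNIV}"

definition lpnorm :: "ereal \<Rightarrow> (int ^ 'c::finite \<Rightarrow> 'a::real_normed_vector) \<Rightarrow> real" where
  "lpnorm p x = (if p = \<infinity> then (SUP k. norm (x k))
     else (infsum (\<lambda>k. norm (x k) powr real_of_ereal p) UNIV) powr (1 / real_of_ereal p))"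

text \<open>Bounded (complex-linear) operators on l_p(Z^c,X); an operator is a map on
  families which is only relevant on the subspace lp p.\<close>
definition Bop :: "('a::banach \<Rightarrow> 'a) \<Rightarrow> ereal \<Rightarrow>
    ((int ^ 'c::finite \<Rightarrow> 'a) \<Rightarrow> (int ^ 'c \<Rightarrow> 'a)) \<Rightarrow> bool" where
  "Bop J p T \<longleftrightarrow> (\<forall>x\<in>lp p. T x \<in> lp p) \<and>
     (\<forall>x\<in>lp p. \<forall>y\<in>lp p. T (\<lambda>k. x k + y k) = (\<lambda>k. T x k + T y k)) \<and>
     (\<forall>x\<in>lp p. \<forall>z. T (\<lambda>k. cscale J z (x k)) = (\<lambda>k. cscale J z (T x k))) \<and>
     (\<exists>C. \<forall>x\<in>lp p. lpnorm p (T x) \<le> C * lpnorm p x)"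

definition is_inverse_op :: "('a::banach \<Rightarrow> 'a) \<Rightarrow> ereal \<Rightarrow>
    ((int ^ 'c::finite \<Rightarrow> 'a) \<Rightarrow> (int ^ 'c \<Rightarrow> 'a)) \<Rightarrow> ((int ^ 'c \<Rightarrow> 'a) \<Rightarrow> (int ^ 'c \<Rightarrow> 'a)) \<Rightarrow> bool" where
  "is_inverse_op J p S R \<longleftrightarrow> Bop J p S \<and> Bop J p R \<and>
     (\<forall>x\<in>lp p. R (S x) = x \<and> S (R x) = x)"

definition locnuc :: "('a::banach \<Rightarrow> 'a) \<Rightarrow> ereal \<Rightarrow> (int ^ 'c::finite \<Rightarrow> real) \<Rightarrow>
    ((int ^ 'c \<Rightarrow> 'a) \<Rightarrow> (int ^ 'c \<Rightarrow> 'a)) \<Rightarrow> bool" where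
  "locnuc J p g T \<longleftrightarrow> Bop J p T \<and>
     (\<exists>\<beta> b. (\<forall>m. \<beta> m \<ge> 0) \<and> l1g g \<beta> \<and>
        (\<forall>k m. nuclear J (b k m) \<and> nuclear_norm J (b k m) \<le> \<beta> m) \<and>
        (\<forall>x\<in>lp p. \<forall>k. ((\<lambda>m. b k m (x (k - m))) has_sum T x k) UNIV))"

definition locnuc_tilde :: "('a::banach \<Rightarrow> 'a) \<Rightarrow> ereal \<Rightarrow> (int ^ 'c::finite \<Rightarrow> real) \<Rightarrow>
    ((int ^ 'c \<Rightarrow> 'a) \<Rightarrow> (int ^ 'c \<Rightarrow> 'a)) \<Rightarrow> bool" where
  "locnuc_tilde J p g S \<longleftrightarrow>
     (if cfindim J then locnuc J p g S
      else (\<exists>lam T. locnuc J p g T \<and> (\<forall>x\<in>lp p. S x = (\<lambda>k. cscale J lam (x k) + T x k))))"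

end

theory Submission
  imports Defs
begin

text \<open>Let \<open>S\<close> have inverse \<open>R\<close> with norm \<open>K\<close>, and let \<open>\<beta>\<close> dominate the diagonals of \<open>S\<close>. For
  \<open>y = R x\<close> put \<open>h j = lpnorm p (\<lambda>k. w (k - j) *\<^sub>R y k)\<close> with \<open>w n = exp (- \<delta> |n|)\<close>. Applying the
  a priori bound \<open>\<parallel>y'\<parallel> \<le> K \<parallel>S y'\<parallel>\<close> to \<open>y' = w (\<cdot> - j) y\<close> and estimating the commutator of \<open>S\<close> with
  multiplication by \<open>w (\<cdot> - j)\<close> gives, when \<open>F\<close> is a large finite set and \<open>\<delta>\<close> is small,
  \<open>h \<le> 2 K w * \<bar>x\<bar> + \<epsilon> * h\<close>, where \<open>\<epsilon>\<close> is \<open>2 K \<beta>\<close> outside \<open>F\<close> and has \<open>g\<close>-norm at most 1/2.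
  Iterating, \<open>h \<le> \<beta>' * \<bar>x\<bar>\<close> with \<open>\<beta>'\<close> summable against \<open>g\<close>; condition (e) enters through the
  summability of \<open>g w\<close>. Hence \<open>R\<close> has a matrix with \<open>g\<close>-summable diagonals for every \<open>p\<close>,
  including infinity.

  Nuclearity then comes from the ideal property. If \<open>S = \<lambda> + T\<close> with \<open>\<lambda> \<noteq> 0\<close>, then
  \<open>R = 1/\<lambda> - (1/\<lambda>) R T\<close>. If \<open>\<lambda> = 0\<close>, the diagonal entry of \<open>T R = 1\<close> shows that the identity of \<open>X\<close>
  is nuclear; so \<open>X\<close> is finite-dimensional and every entry of \<open>R\<close> is nuclear.\<close>

section \<open>Norms on the sequence spaces\<close>

text \<open>Membership and norm bound are treated jointly, because the supremum in
  \<open>lpnorm\<close> carries information only for bounded families.\<close>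

lemma lp_bound_iff_infty:
  fixes x :: "int ^ 'c::finite \<Rightarrow> 'a::real_normed_vector"
  shows "x \<in> lp \<infinity> \<and> lpnorm \<infinity> x \<le> C \<longleftrightarrow> (\<forall>k. norm (x k) \<le> C)"
proof
  assume h: "x \<in> lp \<infinity> \<and> lpnorm \<infinity> x \<le> C"
  then have "bdd_above (range (\<lambda>k. norm (x k)))"
    by (simp add: lp_def bounded_imp_bdd_above)
  then have "norm (x k) \<le> lpnorm \<infinity> x" for k
    unfolding lpnorm_def by (auto intro: cSUP_upper)
  then show "\<forall>k. norm (x k) \<le> C" using h order_trans by blast
next
  assume h: "\<forall>k. norm (x k) \<le> C"
  then show "x \<in> lp \<infinity> \<and> lpnorm \<infinity> x \<le> C"
    unfolding lp_def lpnorm_def by (auto intro!: cSUP_least boundedI[of _ C])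
qed

text \<open>Reduces every claim about \<open>lp p\<close> with finite exponent to inequalities
  between finite sums. Membership then comes for free with the norm bound, since bounded partial
  sums of nonnegative terms are summable.\<close>

lemma lp_bound_iff_finite:
  fixes x :: "int ^ 'c::finite \<Rightarrow> 'a::real_normed_vector"
  assumes "1 \<le> p" "p \<noteq> \<infinity>" "0 \<le> C"
  defines "q \<equiv> real_of_ereal p"
  shows "x \<in> lp p \<and> lpnorm p x \<le> C \<longleftrightarrow>
    (\<forall>A. finite A \<longrightarrow> (\<Sum>k\<in>A. norm (x k) powr q) \<le> C powr q)"
proof -
  have q: "q \<ge> 1" using assms(1,2) unfolding q_def by (cases p) auto
  have pp: "(t powr (1/q) \<le> C) = (t \<le> C powr q)" if "t \<ge> 0" for t
  proof
    assume "t powr (1/q) \<le> C"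
    then have "(t powr (1/q)) powr q \<le> C powr q" using q by (intro powr_mono2) auto
    then show "t \<le> C powr q" using q that by (simp add: powr_powr)
  next
    assume "t \<le> C powr q"
    then have "t powr (1/q) \<le> (C powr q) powr (1/q)" using q that by (intro powr_mono2) auto
    then show "t powr (1/q) \<le> C" using q assms(3) by (simp add: powr_powr)
  qed
  show ?thesis
  proof
    assume h: "x \<in> lp p \<and> lpnorm p x \<le> C"
    then have s: "(\<lambda>k. norm (x k) powr q) summable_on UNIV" using assms(2) by (simp add: lp_def q_def)
    have "infsum (\<lambda>k. norm (x k) powr q) UNIV \<le> C powr q"
      using h assms(2) pp[of "infsum (\<lambda>k. norm (x k) powr q) UNIV"]
      by (simp add: lpnorm_def q_def infsum_nonneg)
    moreover have "(\<Sum>k\<in>A. norm (x k) powr q) \<le> infsum (\<lambda>k. norm (x k) powr q) UNIV" if "finite A" for A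
      using finite_sum_le_infsum[OF s that] by simp
    ultimately show "\<forall>A. finite A \<longrightarrow> (\<Sum>k\<in>A. norm (x k) powr q) \<le> C powr q" by force
  next
    assume h: "\<forall>A. finite A \<longrightarrow> (\<Sum>k\<in>A. norm (x k) powr q) \<le> C powr q"
    have s: "(\<lambda>k. norm (x k) powr q) summable_on UNIV"
      by (rule nonneg_bdd_above_summable_on) (use h in \<open>auto intro!: bdd_aboveI[of _ "C powr q"]\<close>)
    have "infsum (\<lambda>k. norm (x k) powr q) UNIV \<le> C powr q"
      using h by (intro infsum_le_finite_sums[OF s]) auto
    then show "x \<in> lp p \<and> lpnorm p x \<le> C"
      using s pp[of "infsum (\<lambda>k. norm (x k) powr q) UNIV"] assms(2)
      by (simp add: lp_def lpnorm_def q_def infsum_nonneg)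
  qed
qed

lemma lpnorm_nonneg:
  fixes x :: "int ^ 'c::finite \<Rightarrow> 'a::real_normed_vector"
  assumes "x \<in> lp p"
  shows "0 \<le> lpnorm p x"
proof (cases "p = \<infinity>")
  case True
  have "norm (x 0) \<le> lpnorm p x"
    using lp_bound_iff_infty[of x "lpnorm p x"] assms True by simp
  then show ?thesis using norm_ge_zero order_trans by blast
qed (simp add: lpnorm_def)

text \<open>The two families may take values in different spaces, so that families in X can be
  compared with their real majorants.\<close>

lemma lp_mono:
  fixes x :: "int ^ 'c::finite \<Rightarrow> 'a::real_normed_vector" and y :: "int ^ 'c \<Rightarrow> 'b::real_normed_vector"
  assumes "1 \<le> p" "y \<in> lp p" "\<And>k. norm (x k) \<le> norm (y k)"
  shows "x \<in> lp p" "lpnorm p x \<le> lpnorm p y"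
proof -
  have "x \<in> lp p \<and> lpnorm p x \<le> lpnorm p y"
  proof (cases "p = \<infinity>")
    case True
    then show ?thesis
      using lp_bound_iff_infty[of y "lpnorm p y"] lp_bound_iff_infty[of x "lpnorm p y"] assms(2,3)
        order_trans by blast
  next
    case False
    define q where "q = real_of_ereal p"
    have q: "q \<ge> 1" using assms(1) False unfolding q_def by (cases p) auto
    have "(\<Sum>k\<in>A. norm (x k) powr q) \<le> (\<Sum>k\<in>A. norm (y k) powr q)" for A
      using assms(3) q by (intro sum_mono powr_mono2) auto
    then show ?thesis
      using lp_bound_iff_finite[OF assms(1) False lpnorm_nonneg[OF assms(2)], of y]
        lp_bound_iff_finite[OF assms(1) False lpnorm_nonneg[OF assms(2)], of x] assms(2)
      unfolding q_def by (meson order_refl order_trans)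
  qed
  then show "x \<in> lp p" "lpnorm p x \<le> lpnorm p y" by auto
qed

lemma lp_translate:
  fixes x :: "int ^ 'c::finite \<Rightarrow> 'a::real_normed_vector"
  assumes "x \<in> lp p"
  shows "(\<lambda>k. x (k - m)) \<in> lp p" "lpnorm p (\<lambda>k. x (k - m)) = lpnorm p x"
proof -
  have b: "bij (\<lambda>k. k - m)" by (rule bij_betw_byWitness[of _ "\<lambda>k. k + m"]) auto
  have "range (\<lambda>k. norm (x (k - m))) = (\<lambda>k. norm (x k)) ` range (\<lambda>k. k - m)"
    by (simp only: image_image)
  then have r: "range (\<lambda>k. norm (x (k - m))) = range (\<lambda>k. norm (x k))"
    by (simp only: bij_is_surj[OF b])
  show "(\<lambda>k. x (k - m)) \<in> lp p"
    using assms summable_on_reindex_bij_betw[OF b, of "\<lambda>k. norm (x k) powr real_of_ereal p"]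
    by (simp only: lp_def mem_Collect_eq r)
  show "lpnorm p (\<lambda>k. x (k - m)) = lpnorm p x"
    using infsum_reindex_bij_betw[OF b, of "\<lambda>k. norm (x k) powr real_of_ereal p"]
    by (simp only: lpnorm_def r)
qed

lemma norm_le_lpnorm:
  fixes x :: "int ^ 'c::finite \<Rightarrow> 'a::real_normed_vector"
  assumes "1 \<le> p" "x \<in> lp p"
  shows "norm (x k) \<le> lpnorm p x"
proof (cases "p = \<infinity>")
  case True
  then show ?thesis using lp_bound_iff_infty[of x "lpnorm p x"] assms(2) by simp
next
  case False
  define q where "q = real_of_ereal p"
  have q: "q \<ge> 1" using assms(1) False unfolding q_def by (cases p) auto
  have "(\<Sum>k\<in>{k}. norm (x k) powr q) \<le> lpnorm p x powr q"
    using lp_bound_iff_finite[OF assms(1) False lpnorm_nonneg[OF assms(2)], of x] assms(2)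
    unfolding q_def by blast
  then show ?thesis
    using q powr_less_mono2[of q "lpnorm p x" "norm (x k)"] lpnorm_nonneg[OF assms(2)] by force
qed

lemma lp_scale:
  fixes x :: "int ^ 'c::finite \<Rightarrow> 'a::real_normed_vector" and y :: "int ^ 'c \<Rightarrow> 'b::real_normed_vector"
  assumes p: "1 \<le> p" and y: "y \<in> lp p" and c: "0 \<le> c" and le: "\<And>k. norm (x k) \<le> c * norm (y k)"
  shows "x \<in> lp p" "lpnorm p x \<le> c * lpnorm p y"
proof -
  have n: "0 \<le> lpnorm p y" "0 \<le> c * lpnorm p y" using lpnorm_nonneg[OF y] c by auto
  have "x \<in> lp p \<and> lpnorm p x \<le> c * lpnorm p y"
  proof (cases "p = \<infinity>")
    case True
    have "norm (x k) \<le> c * lpnorm p y" for k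
      using le[of k] mult_left_mono[OF norm_le_lpnorm[OF p y, of k] c] by linarith
    then show ?thesis using lp_bound_iff_infty[of x "c * lpnorm p y"] True by simp
  next
    case False
    define q where "q = real_of_ereal p"
    have q: "q \<ge> 1" using p False unfolding q_def by (cases p) auto
    have "(\<Sum>k\<in>A. norm (x k) powr q) \<le> (c * lpnorm p y) powr q" if "finite A" for A
    proof -
      have "(\<Sum>k\<in>A. norm (x k) powr q) \<le> (\<Sum>k\<in>A. (c * norm (y k)) powr q)"
        using le q by (intro sum_mono powr_mono2) auto
      also have "\<dots> = c powr q * (\<Sum>k\<in>A. norm (y k) powr q)"
        using c by (simp add: powr_mult sum_distrib_left)
      also have "\<dots> \<le> c powr q * lpnorm p y powr q"
        using lp_bound_iff_finite[OF p False n(1), of y] y that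
        by (intro mult_left_mono) (auto simp: q_def)
      finally show ?thesis using c n by (simp add: powr_mult)
    qed
    then show ?thesis using lp_bound_iff_finite[OF p False n(2), of x] unfolding q_def by auto
  qed
  then show "x \<in> lp p" "lpnorm p x \<le> c * lpnorm p y" by auto
qed

lemma lp_single:
  fixes v :: "'a::real_normed_vector" and l :: "int ^ 'c::finite"
  assumes "1 \<le> p"
  shows "(\<lambda>k. if k = l then v else 0) \<in> lp p" "lpnorm p (\<lambda>k. if k = l then v else 0) \<le> norm v"
proof -
  let ?x = "\<lambda>k. if k = l then v else 0"
  have "?x \<in> lp p \<and> lpnorm p ?x \<le> norm v"
  proof (cases "p = \<infinity>")
    case True
    then show ?thesis using lp_bound_iff_infty[of ?x "norm v"] by simp
  next
    case False
    define q where "q = real_of_ereal p"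
    have "(\<Sum>k\<in>A. norm (?x k) powr q) = (\<Sum>k\<in>A. if k = l then norm v powr q else 0)" for A
      by (intro sum.cong) auto
    then have "(\<Sum>k\<in>A. norm (?x k) powr q) \<le> norm v powr q" if "finite A" for A
      using that by (simp add: sum.delta)
    then show ?thesis
      using lp_bound_iff_finite[OF assms False norm_ge_zero[of v], of ?x] unfolding q_def by blast
  qed
  then show "?x \<in> lp p" "lpnorm p ?x \<le> norm v" by auto
qed

section \<open>Minkowski's inequality, for two families and for infinite sums\<close>

lemma powr_convex_nonneg:
  fixes q :: real
  assumes "q \<ge> 1" "0 \<le> s" "0 \<le> t" "0 \<le> u" "u \<le> 1"
  shows "(u * s + (1 - u) * t) powr q \<le> u * s powr q + (1 - u) * t powr q"
proof -
  \<comment> \<open>Convexity is at hand on the open half-line. When \<open>s\<close> or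
    \<open>t\<close> vanishes, the claim reduces to this estimate, which is
    \<open>c powr q \<le> c\<close> for \<open>c\<close> in the unit interval.\<close>
  have le: "(c * r) powr q \<le> c * r powr q" if "0 \<le> c" "c \<le> 1" "0 \<le> r" for c r :: real
  proof (cases "c = 0")
    case False
    then have "c powr q \<le> c powr 1" using that assms(1) by (intro powr_mono') auto
    then show ?thesis using that by (simp add: powr_mult mult_right_mono)
  qed simp
  consider "s = 0" | "t = 0" | "s > 0" "t > 0" using assms by linarith
  then show ?thesis
  proof cases
    case 3
    then show ?thesis
      using convex_onD[OF powr_convex[OF assms(1)], of "1 - u" s t] assms by simp
  qed (use le[of "1 - u" t] le[of u s] assms in auto)
qed

text \<open>The normalised families \<open>f / a\<close> and \<open>h / b\<close> lie in the unit
  ball, and \<open>(f + h) / (a + b)\<close> is a convex combination of them; convexity of the power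
  keeps it in the ball. Stating it with bounds \<open>a\<close>, \<open>b\<close> instead of norms
  lets any majorants be used.\<close>

lemma minkowski_sum_powr:
  fixes f h :: "'i \<Rightarrow> real"
  assumes q: "q \<ge> 1" and A: "finite A" and ab: "0 \<le> a" "0 \<le> b"
    and f: "\<And>k. 0 \<le> f k" "(\<Sum>k\<in>A. f k powr q) \<le> a powr q"
    and h: "\<And>k. 0 \<le> h k" "(\<Sum>k\<in>A. h k powr q) \<le> b powr q"
  shows "(\<Sum>k\<in>A. (f k + h k) powr q) \<le> (a + b) powr q"
proof -
  \<comment> \<open>Covers the degenerate bounds \<open>a = 0\<close> or \<open>b = 0\<close>, where
    normalising would divide by zero: that family vanishes on \<open>A\<close>.\<close>
  have z: "u k = 0" if "(\<Sum>k\<in>A. u k powr q) \<le> 0" "k \<in> A" for u k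
    using that A sum_nonneg_eq_0_iff[of A "\<lambda>k. u k powr q"]
    by (auto simp: order_antisym sum_nonneg)
  consider "a = 0" | "b = 0" | "a > 0" "b > 0" using ab by linarith
  then show ?thesis
  proof cases
    case 1
    then have "(\<Sum>k\<in>A. (f k + h k) powr q) = (\<Sum>k\<in>A. h k powr q)"
      using z[of f] f by (intro sum.cong) auto
    then show ?thesis using 1 h by simp
  next
    case 2
    then have "(\<Sum>k\<in>A. (f k + h k) powr q) = (\<Sum>k\<in>A. f k powr q)"
      using z[of h] h by (intro sum.cong) auto
    then show ?thesis using 2 f by simp
  next
    case 3
    define u where "u = a / (a + b)"
    have u: "0 \<le> u" "u \<le> 1" "1 - u = b / (a + b)" using 3 by (auto simp: u_def field_simps)
    have pt: "(f k + h k) powr q \<le> (a + b) powr q *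
        (u * (f k powr q / a powr q) + (1 - u) * (h k powr q / b powr q))" for k
    proof -
      have "f k + h k = (a + b) * (u * (f k / a) + (1 - u) * (h k / b))"
        using 3 unfolding u(3) by (simp add: u_def distrib_left)
      then have "(f k + h k) powr q = (a + b) powr q * (u * (f k / a) + (1 - u) * (h k / b)) powr q"
        using 3 u f(1)[of k] h(1)[of k] by (simp add: powr_mult)
      also have "\<dots> \<le> (a + b) powr q * (u * (f k / a) powr q + (1 - u) * (h k / b) powr q)"
        using 3 u f(1)[of k] h(1)[of k] q by (intro mult_left_mono powr_convex_nonneg) auto
      also have "\<dots> = (a + b) powr q *
        (u * (f k powr q / a powr q) + (1 - u) * (h k powr q / b powr q))"
        using 3 f(1)[of k] h(1)[of k] by (simp add: powr_divide)
      finally show ?thesis .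
    qed
    have "(\<Sum>k\<in>A. (f k + h k) powr q) \<le> (\<Sum>k\<in>A. (a + b) powr q *
        (u * (f k powr q / a powr q) + (1 - u) * (h k powr q / b powr q)))"
      by (intro sum_mono pt)
    also have "\<dots> = (a + b) powr q * (u * ((\<Sum>k\<in>A. f k powr q) / a powr q) +
        (1 - u) * ((\<Sum>k\<in>A. h k powr q) / b powr q))"
      by (simp add: sum_distrib_left sum.distrib sum_divide_distrib distrib_left)
    also have "\<dots> \<le> (a + b) powr q * (u * 1 + (1 - u) * 1)"
      using 3 u f h by (intro mult_left_mono add_mono) (auto simp: divide_le_eq_1)
    finally show ?thesis by simp
  qed
qed

lemma lp_triangle:
  fixes x :: "int ^ 'c::finite \<Rightarrow> 'a::real_normed_vector" and y :: "int ^ 'c \<Rightarrow> 'b::real_normed_vector"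
    and z :: "int ^ 'c \<Rightarrow> 'd::real_normed_vector"
  assumes p: "1 \<le> p" and x: "x \<in> lp p" and y: "y \<in> lp p"
    and z: "\<And>k. norm (z k) \<le> norm (x k) + norm (y k)"
  shows "z \<in> lp p" "lpnorm p z \<le> lpnorm p x + lpnorm p y"
proof -
  have n: "0 \<le> lpnorm p x" "0 \<le> lpnorm p y" using x y lpnorm_nonneg by auto
  have "z \<in> lp p \<and> lpnorm p z \<le> lpnorm p x + lpnorm p y"
  proof (cases "p = \<infinity>")
    case True
    have "norm (z k) \<le> lpnorm p x + lpnorm p y" for k
      using z[of k] norm_le_lpnorm[OF p x, of k] norm_le_lpnorm[OF p y, of k] by linarith
    then show ?thesis using lp_bound_iff_infty[of z] True by simp
  next
    case False
    define q where "q = real_of_ereal p"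
    have q: "q \<ge> 1" using p False unfolding q_def by (cases p) auto
    have "(\<Sum>k\<in>A. norm (z k) powr q) \<le> (lpnorm p x + lpnorm p y) powr q" if A: "finite A" for A
    proof -
      have "(\<Sum>k\<in>A. norm (z k) powr q) \<le> (\<Sum>k\<in>A. (norm (x k) + norm (y k)) powr q)"
        using z q by (intro sum_mono powr_mono2) auto
      also have "\<dots> \<le> (lpnorm p x + lpnorm p y) powr q"
        using lp_bound_iff_finite[OF p False n(1), of x] lp_bound_iff_finite[OF p False n(2), of y] x y A
        by (intro minkowski_sum_powr[OF q A n]) (auto simp: q_def)
      finally show ?thesis .
    qed
    then show ?thesis
      using lp_bound_iff_finite[OF p False, of "lpnorm p x + lpnorm p y" z] n unfolding q_def by auto
  qed
  then show "z \<in> lp p" "lpnorm p z \<le> lpnorm p x + lpnorm p y" by auto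
qed

text \<open>The triangle inequality for infinite sums: finite partial sums in \<open>m\<close> obey
  it by induction, and for a fixed finite set of sites \<open>k\<close> the bound survives the limit
  in \<open>m\<close>. No density or completeness of \<open>lp p\<close> is invoked, so the infinite
  exponent is included.\<close>

lemma lp_infsum:
  fixes a :: "'i \<Rightarrow> int ^ 'c::finite \<Rightarrow> real" and z :: "int ^ 'c \<Rightarrow> 'd::real_normed_vector"
  assumes p: "1 \<le> p" and a: "\<And>m. a m \<in> lp p" and nn: "\<And>m k. 0 \<le> a m k"
    and s: "b summable_on UNIV" and ab: "\<And>m. lpnorm p (a m) \<le> b m"
    and z: "\<And>k. norm (z k) \<le> (\<Sum>\<^sub>\<infinity>m. a m k)"
  shows "z \<in> lp p" "lpnorm p z \<le> (\<Sum>\<^sub>\<infinity>m. b m)"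
proof -
  have ak: "a m k \<le> b m" for m k
    using norm_le_lpnorm[OF p a[of m], of k] nn[of m k] ab[of m] by simp
  have b0: "0 \<le> b m" for m using lpnorm_nonneg[OF a[of m]] ab[of m] by linarith
  have sk: "(\<lambda>m. a m k) summable_on UNIV" for k
    by (rule summable_on_comparison_test[OF s]) (use ak nn in auto)
  have B0: "0 \<le> (\<Sum>\<^sub>\<infinity>m. b m)" using b0 by (simp add: infsum_nonneg)
  have "z \<in> lp p \<and> lpnorm p z \<le> (\<Sum>\<^sub>\<infinity>m. b m)"
  proof (cases "p = \<infinity>")
    case True
    have "norm (z k) \<le> (\<Sum>\<^sub>\<infinity>m. b m)" for k
      using z[of k] infsum_mono[OF sk[of k] s ak] by linarith
    then show ?thesis using lp_bound_iff_infty[of z] True by simp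
  next
    case False
    define q where "q = real_of_ereal p"
    have q: "q \<ge> 1" using p False unfolding q_def by (cases p) auto
    have fin: "(\<lambda>k. \<Sum>m\<in>M. a m k) \<in> lp p \<and> lpnorm p (\<lambda>k. \<Sum>m\<in>M. a m k) \<le> (\<Sum>m\<in>M. b m)"
      if "finite M" for M using that
    proof (induction M)
      case empty
      show ?case using lp_bound_iff_finite[OF p False, of 0 "\<lambda>k. 0::real"] by simp
    next
      case (insert m M)
      have "norm (\<Sum>i\<in>insert m M. a i k) \<le> norm (a m k) + norm (\<Sum>i\<in>M. a i k)" for k
        using insert by (simp add: nn sum_nonneg)
      note t = lp_triangle[OF p a[of m] conjunct1[OF insert.IH] this]
      show ?case using t ab[of m] insert by simp
    qed
    have "(\<Sum>k\<in>A. norm (z k) powr q) \<le> (\<Sum>\<^sub>\<infinity>m. b m) powr q" if A: "finite A" for A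
    proof -
      have "(\<Sum>k\<in>A. (\<Sum>m\<in>M. a m k) powr q) \<le> (\<Sum>\<^sub>\<infinity>m. b m) powr q" if M: "finite M" for M
      proof -
        have "lpnorm p (\<lambda>k. \<Sum>m\<in>M. a m k) \<le> (\<Sum>\<^sub>\<infinity>m. b m)"
          using fin[OF M] finite_sum_le_infsum[OF s M] b0 by force
        then show ?thesis
          using lp_bound_iff_finite[OF p False B0, of "\<lambda>k. \<Sum>m\<in>M. a m k"] fin[OF M] A
          by (simp add: q_def nn sum_nonneg)
      qed
      \<comment> \<open>The sum over \<open>k\<close> is finite, so the limit over finite sets
        \<open>M\<close> may be taken term by term; the power is continuous at zero too because the
        exponent is positive.\<close>
      moreover have "((\<lambda>M. \<Sum>k\<in>A. (\<Sum>m\<in>M. a m k) powr q) \<longlongrightarrow> (\<Sum>k\<in>A. (\<Sum>\<^sub>\<infinity>m. a m k) powr q))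
          (finite_subsets_at_top UNIV)"
        using q by (intro tendsto_sum tendsto_powr' infsum_tendsto sk tendsto_const)
          (auto simp: nn sum_nonneg)
      ultimately have "(\<Sum>k\<in>A. (\<Sum>\<^sub>\<infinity>m. a m k) powr q) \<le> (\<Sum>\<^sub>\<infinity>m. b m) powr q"
        by (intro tendsto_upperbound[OF _ _ finite_subsets_at_top_neq_bot])
          (auto simp: eventually_finite_subsets_at_top)
      moreover have "(\<Sum>k\<in>A. norm (z k) powr q) \<le> (\<Sum>k\<in>A. (\<Sum>\<^sub>\<infinity>m. a m k) powr q)"
        using z q by (intro sum_mono powr_mono2) auto
      ultimately show ?thesis by linarith
    qed
    then show ?thesis
      using lp_bound_iff_finite[OF p False B0, of z] unfolding q_def by auto
  qed
  then show "z \<in> lp p" "lpnorm p z \<le> (\<Sum>\<^sub>\<infinity>m. b m)" by auto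
qed

section \<open>Weighted convolution\<close>

definition conv :: "('g::ab_group_add \<Rightarrow> real) \<Rightarrow> ('g \<Rightarrow> real) \<Rightarrow> 'g \<Rightarrow> real" where
  "conv a b j = (\<Sum>\<^sub>\<infinity>m. a m * b (j - m))"

text \<open>The substitution \<open>(j, m)\<close> to \<open>(m, j - m)\<close> turns the double
  family into the product family \<open>a m * b l\<close>.\<close>

lemma conv_summable_pairs:
  fixes a b :: "'g::ab_group_add \<Rightarrow> real"
  assumes "a summable_on UNIV" "b summable_on UNIV" "\<And>m. 0 \<le> a m" "\<And>m. 0 \<le> b m"
  shows "(\<lambda>(j, m). a m * b (j - m)) summable_on UNIV \<times> UNIV"
    "(\<Sum>\<^sub>\<infinity>(j, m)\<in>UNIV \<times> UNIV. a m * b (j - m)) = infsum a UNIV * infsum b UNIV"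
proof -
  have bij: "bij_betw (\<lambda>(j, m). (m, j - m)) (UNIV \<times> UNIV) (UNIV \<times> (UNIV :: 'g set))"
    by (rule bij_betw_byWitness[of _ "\<lambda>(m, l). (l + m, m)"]) auto
  have s: "(\<lambda>(m, l). a m * b l) summable_on UNIV \<times> UNIV"
    by (rule summable_on_SigmaI[where g = "\<lambda>m. a m * infsum b UNIV"])
      (use assms in \<open>auto intro!: has_sum_cmult_right has_sum_infsum summable_on_cmult_left\<close>)
  show "(\<lambda>(j, m). a m * b (j - m)) summable_on UNIV \<times> UNIV"
    using s summable_on_reindex_bij_betw[OF bij, of "\<lambda>(m, l). a m * b l"]
    by (simp add: case_prod_unfold)
  have "(\<Sum>\<^sub>\<infinity>(j, m)\<in>UNIV \<times> UNIV. a m * b (j - m)) = (\<Sum>\<^sub>\<infinity>(m, l)\<in>UNIV \<times> UNIV. a m * b l)"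
    using infsum_reindex_bij_betw[OF bij, of "\<lambda>(m, l). a m * b l"]
    by (simp add: case_prod_unfold)
  also have "\<dots> = (\<Sum>\<^sub>\<infinity>m. \<Sum>\<^sub>\<infinity>l. a m * b l)"
    using infsum_Sigma'_banach[OF s] by simp
  also have "\<dots> = infsum a UNIV * infsum b UNIV"
    using assms by (simp add: infsum_cmult_right infsum_cmult_left)
  finally show "(\<Sum>\<^sub>\<infinity>(j, m)\<in>UNIV \<times> UNIV. a m * b (j - m)) = infsum a UNIV * infsum b UNIV" .
qed

lemma conv_summable:
  fixes a b :: "'g::ab_group_add \<Rightarrow> real"
  assumes "a summable_on UNIV" "b summable_on UNIV" "\<And>m. 0 \<le> a m" "\<And>m. 0 \<le> b m"
  shows "(\<lambda>m. a m * b (j - m)) summable_on UNIV"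
    "conv a b summable_on UNIV" "infsum (conv a b) UNIV = infsum a UNIV * infsum b UNIV"
proof -
  note s = conv_summable_pairs[OF assms]
  show "(\<lambda>m. a m * b (j - m)) summable_on UNIV"
    using summable_on_SigmaD1[OF s(1), of j] by simp
  show "conv a b summable_on UNIV"
    using summable_on_Sigma_banach[OF s(1)] by (simp add: conv_def[abs_def])
  show "infsum (conv a b) UNIV = infsum a UNIV * infsum b UNIV"
    using infsum_Sigma'_banach[OF s(1)] s(2) by (simp add: conv_def[abs_def])
qed

lemma conv_nonneg: "(\<And>m. 0 \<le> a m) \<Longrightarrow> (\<And>m. 0 \<le> b m) \<Longrightarrow> 0 \<le> conv a b j"
  unfolding conv_def by (intro infsum_nonneg) simp

text \<open>A summable kernel against a merely bounded family. This suffices for all exponents at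
  once, since each element of \<open>lp p\<close> is bounded by its norm.\<close>

lemma conv_bounded_summable:
  fixes a u :: "'g::ab_group_add \<Rightarrow> real"
  assumes "a summable_on UNIV" "\<And>m. 0 \<le> a m" "\<And>m. \<bar>u m\<bar> \<le> U"
  shows "(\<lambda>m. a m * u (j - m)) summable_on UNIV"
proof (rule abs_summable_summable)
  show "(\<lambda>m. norm (a m * u (j - m))) summable_on UNIV"
    using assms by (intro summable_on_comparison_test[OF summable_on_cmult_left[OF assms(1), of U]])
      (auto simp: abs_mult intro: mult_left_mono)
qed

lemma conv_mono:
  fixes a u v :: "'g::ab_group_add \<Rightarrow> real"
  assumes "a summable_on UNIV" "\<And>m. 0 \<le> a m" "\<And>m. 0 \<le> u m" "\<And>m. u m \<le> v m" "\<And>m. v m \<le> V"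
  shows "conv a u j \<le> conv a v j"
proof -
  have "\<bar>u m\<bar> \<le> V" "\<bar>v m\<bar> \<le> V" for m
    using assms(3,4,5)[of m] by linarith+
  then show ?thesis unfolding conv_def
    using assms by (intro infsum_mono conv_bounded_summable[OF assms(1,2)] mult_left_mono) auto
qed

lemma conv_le:
  fixes a u :: "'g::ab_group_add \<Rightarrow> real"
  assumes "a summable_on UNIV" "\<And>m. 0 \<le> a m" "\<And>m. 0 \<le> u m" "\<And>m. u m \<le> U"
  shows "conv a u j \<le> infsum a UNIV * U"
proof -
  have "conv a u j \<le> conv a (\<lambda>_. U) j" by (rule conv_mono[of _ _ _ U]) (use assms in auto)
  then show ?thesis unfolding conv_def using assms(1) by (simp add: infsum_cmult_left)
qed

lemma conv_add_right:
  fixes a u v :: "'g::ab_group_add \<Rightarrow> real"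
  assumes "a summable_on UNIV" "\<And>m. 0 \<le> a m" "\<And>m. \<bar>u m\<bar> \<le> U" "\<And>m. \<bar>v m\<bar> \<le> V"
  shows "conv a (\<lambda>m. u m + v m) j = conv a u j + conv a v j"
  unfolding conv_def
  unfolding distrib_left
  by (rule infsum_add[OF conv_bounded_summable[OF assms(1,2,3)] conv_bounded_summable[OF assms(1,2,4)]])

lemma conv_add_left:
  fixes a b u :: "'g::ab_group_add \<Rightarrow> real"
  assumes "a summable_on UNIV" "\<And>m. 0 \<le> a m" "b summable_on UNIV" "\<And>m. 0 \<le> b m"
    "\<And>m. \<bar>u m\<bar> \<le> U"
  shows "conv (\<lambda>m. a m + b m) u j = conv a u j + conv b u j"
  unfolding conv_def
  unfolding distrib_right
  by (rule infsum_add[OF conv_bounded_summable[OF assms(1,2,5)] conv_bounded_summable[OF assms(3,4,5)]])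

text \<open>After the shift \<open>l = n + m\<close> both sides are iterated sums of one double
  family. It is absolutely summable, with majorant \<open>U\<close> times the family of
  \<open>conv_summable_pairs\<close>, so the order of summation may be exchanged.\<close>

lemma conv_assoc:
  fixes a b u :: "'g::ab_group_add \<Rightarrow> real"
  assumes a: "a summable_on UNIV" "\<And>m. 0 \<le> a m" and b: "b summable_on UNIV" "\<And>m. 0 \<le> b m"
    and u: "\<And>m. \<bar>u m\<bar> \<le> U"
  shows "conv a (conv b u) j = conv (conv a b) u j"
proof -
  have shift: "(\<Sum>\<^sub>\<infinity>n. b n * u (j - m - n)) = (\<Sum>\<^sub>\<infinity>l. b (l - m) * u (j - l))" for m
    by (rule infsum_reindex_bij_witness[of _ "\<lambda>l. l - m" "\<lambda>n. n + m"]) (auto simp: algebra_simps)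
  have s: "(\<lambda>(l, m). a m * b (l - m) * u (j - l)) summable_on UNIV \<times> UNIV"
  proof (rule abs_summable_summable)
    show "(\<lambda>x. norm (case x of (l, m) \<Rightarrow> a m * b (l - m) * u (j - l))) summable_on UNIV \<times> UNIV"
      by (rule summable_on_comparison_test[OF summable_on_cmult_left[OF conv_summable_pairs(1)[OF a(1) b(1) a(2) b(2)], of U]])
        (use a b u in \<open>auto simp: abs_mult intro!: mult_left_mono mult_nonneg_nonneg\<close>)
  qed
  have "conv a (conv b u) j = (\<Sum>\<^sub>\<infinity>m. \<Sum>\<^sub>\<infinity>l. a m * b (l - m) * u (j - l))"
    unfolding conv_def shift by (simp add: infsum_cmult_right' mult.assoc)
  also have "\<dots> = (\<Sum>\<^sub>\<infinity>l. \<Sum>\<^sub>\<infinity>m. a m * b (l - m) * u (j - l))"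
    using infsum_swap_banach[OF s] by simp
  also have "\<dots> = conv (conv a b) u j"
    unfolding conv_def by (simp add: infsum_cmult_left')
  finally show ?thesis .
qed

text \<open>Submultiplicativity \<open>g j \<le> g m * g (j - m)\<close> gives the pointwise bound
  of \<open>g\<close> times the convolution by the convolution of the weighted families. Thus the
  weighted summable families form a convolution algebra.\<close>

lemma conv_weighted:
  fixes a b g :: "'g::ab_group_add \<Rightarrow> real"
  assumes g: "\<And>m. 1 \<le> g m" "\<And>m n. g (m + n) \<le> g m * g n"
    and a: "(\<lambda>m. g m * a m) summable_on UNIV" "\<And>m. 0 \<le> a m"
    and b: "(\<lambda>m. g m * b m) summable_on UNIV" "\<And>m. 0 \<le> b m"
  shows "(\<lambda>m. g m * conv a b m) summable_on UNIV"
    "(\<Sum>\<^sub>\<infinity>m. g m * conv a b m) \<le> (\<Sum>\<^sub>\<infinity>m. g m * a m) * (\<Sum>\<^sub>\<infinity>m. g m * b m)"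
proof -
  have g0: "0 \<le> g m" for m using g(1)[of m] by linarith
  have nn: "0 \<le> g m * a m" "0 \<le> g m * b m" for m using g0 a b by auto
  note c = conv_summable[OF a(1) b(1) nn]
  have pt: "g j * conv a b j \<le> conv (\<lambda>m. g m * a m) (\<lambda>m. g m * b m) j" for j
  proof -
    have le: "g j * (a m * b (j - m)) \<le> g m * a m * (g (j - m) * b (j - m))" for m
      using mult_right_mono[OF g(2)[of m "j - m"], of "a m * b (j - m)"] a(2) b(2) by (simp add: ac_simps)
    have s: "(\<lambda>m. g j * (a m * b (j - m))) summable_on UNIV"
      by (rule summable_on_comparison_test[OF c(1)[of j] le]) (use g0 a b in auto)
    have "g j * conv a b j = (\<Sum>\<^sub>\<infinity>m. g j * (a m * b (j - m)))"
      unfolding conv_def by (simp add: infsum_cmult_right')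
    also have "\<dots> \<le> (\<Sum>\<^sub>\<infinity>m. g m * a m * (g (j - m) * b (j - m)))"
      by (rule infsum_mono[OF s c(1) le])
    finally show ?thesis by (simp add: conv_def)
  qed
  show s: "(\<lambda>m. g m * conv a b m) summable_on UNIV"
    by (rule summable_on_comparison_test[OF c(2) pt]) (intro mult_nonneg_nonneg g0 conv_nonneg a(2) b(2))
  show "(\<Sum>\<^sub>\<infinity>m. g m * conv a b m) \<le> (\<Sum>\<^sub>\<infinity>m. g m * a m) * (\<Sum>\<^sub>\<infinity>m. g m * b m)"
    using infsum_mono[OF s c(2) pt] c(3) by simp
qed

lemma summable_of_weighted:
  fixes a g :: "'g \<Rightarrow> real"
  assumes "\<And>m. 1 \<le> g m" "(\<lambda>m. g m * a m) summable_on UNIV" "\<And>m. 0 \<le> a m"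
  shows "a summable_on UNIV" "infsum a UNIV \<le> (\<Sum>\<^sub>\<infinity>m. g m * a m)"
proof -
  have le: "a m \<le> g m * a m" for m
    using mult_right_mono[OF assms(1)[of m] assms(3)[of m]] by simp
  show s: "a summable_on UNIV"
    by (rule summable_on_comparison_test[OF assms(2) le]) (use assms in auto)
  show "infsum a UNIV \<le> (\<Sum>\<^sub>\<infinity>m. g m * a m)"
    by (rule infsum_mono[OF s assms(2) le])
qed

section \<open>Neumann series for convolution inequalities\<close>

lemma summable_of_finite_bounds:
  fixes f :: "'g \<Rightarrow> real"
  assumes "\<And>m. 0 \<le> f m" "\<And>A. finite A \<Longrightarrow> sum f A \<le> C"
  shows "f summable_on UNIV"
  by (rule nonneg_bdd_above_summable_on) (use assms in \<open>auto intro!: bdd_aboveI[of _ C]\<close>)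

text \<open>The partial sums of the Neumann series: stage \<open>n\<close> is the sum over
  \<open>i < n\<close> of the \<open>i\<close>-fold convolution power of \<open>\<epsilon>\<close>,
  convolved with \<open>w\<close>.\<close>

fun conv_iter :: "('g::ab_group_add \<Rightarrow> real) \<Rightarrow> ('g \<Rightarrow> real) \<Rightarrow> nat \<Rightarrow> 'g \<Rightarrow> real" where
  "conv_iter \<epsilon> w 0 = (\<lambda>_. 0)"
| "conv_iter \<epsilon> w (Suc n) = (\<lambda>m. w m + conv \<epsilon> (conv_iter \<epsilon> w n) m)"

text \<open>Substituting \<open>h \<le> w * u + \<epsilon> * h\<close> into itself \<open>n\<close>
  times leaves a partial Neumann series applied to \<open>u\<close> and a remainder that halves each
  time. The same \<open>\<beta>\<close> serves all \<open>u\<close> and \<open>h\<close>; the bounds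
  \<open>U\<close> and \<open>H\<close> may vary with them and enter only through convergence and
  the remainder.\<close>

lemma conv_resolvent_bound:
  fixes g \<epsilon> w :: "'g::ab_group_add \<Rightarrow> real"
  assumes g: "\<And>m. 1 \<le> g m" "\<And>m n. g (m + n) \<le> g m * g n"
    and e: "(\<lambda>m. g m * \<epsilon> m) summable_on UNIV" "\<And>m. 0 \<le> \<epsilon> m" "(\<Sum>\<^sub>\<infinity>m. g m * \<epsilon> m) \<le> 1 / 2"
    and w: "(\<lambda>m. g m * w m) summable_on UNIV" "\<And>m. 0 \<le> w m"
  obtains \<beta> where "(\<lambda>m. g m * \<beta> m) summable_on UNIV" "\<And>m. 0 \<le> \<beta> m"
    "\<And>h u H U j. \<lbrakk>\<And>i. 0 \<le> u i; \<And>i. u i \<le> U; \<And>i. 0 \<le> h i; \<And>i. h i \<le> H;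
       \<And>i. h i \<le> conv w u i + conv \<epsilon> h i\<rbrakk> \<Longrightarrow> h j \<le> conv \<beta> u j"
proof -
  define \<phi> where "\<phi> = conv_iter \<epsilon> w"
  have \<phi>0: "\<phi> 0 = (\<lambda>_. 0)" and \<phi>S: "\<phi> (Suc n) m = w m + conv \<epsilon> (\<phi> n) m" for n m
    by (simp_all add: \<phi>_def)
  \<comment> \<open>The value with \<open>C / 2 + 1 / 2 * C = C\<close>, so that the bound
    reproduces itself along the recursion.\<close>
  define C where "C = 2 * (\<Sum>\<^sub>\<infinity>m. g m * w m)"
  have g0: "0 \<le> g m" for m using g(1)[of m] by linarith
  have C0: "0 \<le> C" unfolding C_def using g0 w by (simp add: infsum_nonneg)
  have \<phi>nn: "0 \<le> \<phi> n m" for n m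
    by (induction n arbitrary: m) (auto simp: \<phi>0 \<phi>S w e conv_nonneg)
  note es = summable_of_weighted[OF g(1) e(1,2)]
  note ws = summable_of_weighted[OF g(1) w]
  have es2: "infsum \<epsilon> UNIV \<le> 1 / 2" using es(2) e(3) by linarith
  have \<phi>s: "(\<lambda>m. g m * \<phi> n m) summable_on UNIV \<and> (\<Sum>\<^sub>\<infinity>m. g m * \<phi> n m) \<le> C" for n
  proof (induction n)
    case 0
    show ?case using C0 by (simp add: \<phi>0)
  next
    case (Suc n)
    note cw = conv_weighted[OF g e(1,2) conjunct1[OF Suc] \<phi>nn]
    have "(\<Sum>\<^sub>\<infinity>m. g m * \<phi> (Suc n) m) = C / 2 + (\<Sum>\<^sub>\<infinity>m. g m * conv \<epsilon> (\<phi> n) m)"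
      unfolding \<phi>S distrib_left C_def by (subst infsum_add[OF w(1) cw(1)]) simp
    moreover have "(\<Sum>\<^sub>\<infinity>m. g m * \<epsilon> m) * (\<Sum>\<^sub>\<infinity>m. g m * \<phi> n m) \<le> 1 / 2 * C"
      using e(3) Suc by (intro mult_mono) (auto intro!: infsum_nonneg simp: g0 \<phi>nn)
    moreover have "(\<lambda>m. g m * \<phi> (Suc n) m) summable_on UNIV"
      unfolding \<phi>S distrib_left by (rule summable_on_add[OF w(1) cw(1)])
    ultimately show ?case using cw(2) by linarith
  qed
  have \<phi>s1: "\<phi> n summable_on UNIV" for n
    using summable_of_weighted(1)[OF g(1) conjunct1[OF \<phi>s] \<phi>nn] .
  have fin: "sum (\<lambda>m. g m * \<phi> n m) A \<le> C" if "finite A" for A n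
    using finite_sum_le_infsum[of "\<lambda>m. g m * \<phi> n m" UNIV A] \<phi>s[of n] that g0 \<phi>nn by fastforce
  have \<phi>b: "\<phi> n m \<le> C" for n m
    using fin[where A = "{m}" and n = n] mult_right_mono[OF g(1)[of m] \<phi>nn[of n m]] by simp
  have mono: "\<phi> n m \<le> \<phi> (Suc n) m" for n m
  proof (induction n arbitrary: m)
    case 0
    show ?case using \<phi>nn[of 1 m] by (simp add: \<phi>0)
  next
    case (Suc n)
    have "conv \<epsilon> (\<phi> n) m \<le> conv \<epsilon> (\<phi> (Suc n)) m"
      by (rule conv_mono[where V = C]) (use es e \<phi>nn \<phi>b Suc in auto)
    then show ?case by (simp add: \<phi>S)
  qed
  have inc: "incseq (\<lambda>n. \<phi> n m)" for m using mono by (simp add: incseq_Suc_iff)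
  \<comment> \<open>The stages increase, so the Neumann series is their supremum; the uniform bound
    \<open>C\<close> on finite weighted sums passes to it.\<close>
  define \<beta> where "\<beta> m = (SUP n. \<phi> n m)" for m
  have bdd: "bdd_above (range (\<lambda>n. \<phi> n m))" for m using \<phi>b by (auto intro: bdd_aboveI[of _ C])
  have lim: "(\<lambda>n. \<phi> n m) \<longlonglongrightarrow> \<beta> m" for m
    unfolding \<beta>_def by (rule LIMSEQ_incseq_SUP[OF bdd inc])
  have \<phi>\<beta>: "\<phi> n m \<le> \<beta> m" for n m unfolding \<beta>_def by (rule cSUP_upper[OF _ bdd]) simp
  have \<beta>0: "0 \<le> \<beta> m" for m using \<phi>\<beta>[of 0 m] by (simp add: \<phi>0)
  have \<beta>s: "(\<lambda>m. g m * \<beta> m) summable_on UNIV"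
  proof (rule summable_of_finite_bounds)
    fix A :: "'g set" assume A: "finite A"
    have "(\<lambda>n. \<Sum>m\<in>A. g m * \<phi> n m) \<longlonglongrightarrow> (\<Sum>m\<in>A. g m * \<beta> m)"
      by (intro tendsto_intros lim)
    then show "(\<Sum>m\<in>A. g m * \<beta> m) \<le> C"
      using fin[OF A] by (intro LIMSEQ_le_const2) auto
  qed (use g0 \<beta>0 in auto)
  note \<beta>s1 = summable_of_weighted(1)[OF g(1) \<beta>s \<beta>0]
  have main: "h j \<le> conv \<beta> u j"
    if u: "\<And>i. 0 \<le> u i" "\<And>i. u i \<le> U" and h: "\<And>i. 0 \<le> h i" "\<And>i. h i \<le> H"
      and hu: "\<And>i. h i \<le> conv w u i + conv \<epsilon> h i" for h u H U j
  proof -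
    have ua: "\<bar>u i\<bar> \<le> U" for i using u[of i] by simp
    have H0: "0 \<le> H" using h[of 0] by linarith
    \<comment> \<open>The remainder after \<open>n\<close> substitutions is at most
      \<open>H / 2 ^ n\<close>, as \<open>\<epsilon>\<close> has total mass at most 1/2.\<close>
    have it: "h i \<le> conv (\<phi> n) u i + H / 2 ^ n" for n i
    proof (induction n arbitrary: i)
      case 0
      show ?case using h by (simp add: \<phi>0 conv_def)
    next
      case (Suc n)
      let ?v = "conv (\<phi> n) u"
      define V where "V = infsum (\<phi> n) UNIV * U"
      have v: "0 \<le> ?v i" "?v i \<le> V" for i
        using conv_nonneg[of "\<phi> n" u i] conv_le[of "\<phi> n" u U i] \<phi>s1 \<phi>nn u by (auto simp: V_def)
      have Hn: "0 \<le> H / 2 ^ n" using H0 by simp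
      have "conv \<epsilon> h i \<le> conv \<epsilon> (\<lambda>i. ?v i + H / 2 ^ n) i"
        by (rule conv_mono[where V = "V + H / 2 ^ n"]) (use es e h Suc v in auto)
      also have "\<dots> = conv \<epsilon> ?v i + conv \<epsilon> (\<lambda>_. H / 2 ^ n) i"
        by (rule conv_add_right[where U = V and V = "H / 2 ^ n"]) (use es e v Hn in auto)
      also have "conv \<epsilon> ?v i = conv (conv \<epsilon> (\<phi> n)) u i"
        by (rule conv_assoc[where U = U]) (use es e \<phi>s1 \<phi>nn ua in auto)
      also have "conv \<epsilon> (\<lambda>_. H / 2 ^ n) i \<le> infsum \<epsilon> UNIV * (H / 2 ^ n)"
        by (rule conv_le[OF es(1) e(2)]) (use Hn in auto)
      also have "\<dots> \<le> 1 / 2 * (H / 2 ^ n)" by (rule mult_right_mono[OF es2 Hn])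
      finally have "h i \<le> conv w u i + conv (conv \<epsilon> (\<phi> n)) u i + H / 2 ^ Suc n"
        using hu[of i] by simp
      also have "conv w u i + conv (conv \<epsilon> (\<phi> n)) u i = conv (\<phi> (Suc n)) u i"
        unfolding \<phi>S[abs_def]
        by (rule conv_add_left[symmetric, where U = U])
          (use ws w conv_summable(2)[of \<epsilon> "\<phi> n"] conv_nonneg[of \<epsilon> "\<phi> n"] es e \<phi>s1 \<phi>nn ua in auto)
      finally show ?case .
    qed
    have "conv (\<phi> n) u j \<le> conv \<beta> u j" for n
      unfolding conv_def
      by (intro infsum_mono conv_bounded_summable[where U = U] \<phi>s1 \<phi>nn ua \<beta>s1 \<beta>0
          mult_right_mono u \<phi>\<beta>)
    then have "h j \<le> conv \<beta> u j + H / 2 ^ n" for n using it[of j n] by (meson add_right_mono order_trans)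
    moreover have "(\<lambda>n. conv \<beta> u j + H * (1 / 2) ^ n) \<longlonglongrightarrow> conv \<beta> u j + H * 0"
      by (intro tendsto_intros LIMSEQ_power_zero) auto
    ultimately show ?thesis
      by (intro LIMSEQ_le_const[of "\<lambda>n. conv \<beta> u j + H * (1 / 2) ^ n"]) (auto simp: power_one_over)
  qed
  show ?thesis by (rule that[OF \<beta>s \<beta>0]) (use main in blast)
qed

section \<open>Summability of the weight against exponentially decaying factors\<close>

lemma weight_exp_summable_int:
  fixes g :: "int ^ 'c::finite \<Rightarrow> real"
  assumes g: "weight g" and d: "0 < \<delta>"
  shows "(\<lambda>z::int. g (z *s t) * exp (- \<delta> * \<bar>real_of_int z\<bar>)) summable_on UNIV"
proof -
  let ?f = "\<lambda>z::int. g (z *s t) * exp (- \<delta> * \<bar>real_of_int z\<bar>)"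
  have g0: "0 < g m" for m using g by (simp add: weight_def)
  have sym: "?f (- z) = ?f z" for z
    using g unfolding weight_def by (metis abs_minus_cancel of_int_minus vector_sneg_minus1 vector_smult_assoc mult_minus1)
  have "(\<lambda>n::nat. root n (g (int n *s t))) \<longlonglongrightarrow> 1" using g by (simp add: weight_def)
  \<comment> \<open>Condition (e) says that \<open>g\<close> grows subexponentially along a ray.
    Half of the decay rate \<open>\<delta>\<close> pays for this growth; the other half leaves a
    geometric series.\<close>
  then have "eventually (\<lambda>n::nat. root n (g (int n *s t)) < exp (\<delta> / 2)) sequentially"
    using d by (intro order_tendstoD) auto
  then have "eventually (\<lambda>n::nat. norm (?f (int n)) \<le> exp (- \<delta> / 2) ^ n) sequentially"
    \<comment> \<open>The index must be positive for the power to undo the root, since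
      \<open>root 0\<close> is constantly zero.\<close>
    using eventually_gt_at_top[of 0]
  proof eventually_elim
    case (elim n)
    have "g (int n *s t) = root n (g (int n *s t)) ^ n"
      using elim g0[of "int n *s t"] by simp
    also have "\<dots> \<le> exp (\<delta> / 2) ^ n"
      using elim g0[of "int n *s t"] by (intro power_mono) auto
    finally have "?f (int n) \<le> exp (\<delta> / 2) ^ n * exp (- \<delta> * n)"
      by (intro mult_mono) auto
    also have "\<dots> = exp (- \<delta> / 2) ^ n"
      by (simp add: exp_of_nat_mult[symmetric] exp_add[symmetric] algebra_simps)
    finally show ?case using g0[of "int n *s t"] by simp
  qed
  then have "summable (\<lambda>n::nat. ?f (int n))"
    using d by (intro summable_comparison_test_ev[OF _ summable_geometric]) auto
  then have s: "(\<lambda>n::nat. ?f (int n)) summable_on UNIV"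
    using g0 by (intro summable_nonneg_imp_summable_on) (auto intro: less_imp_le)
  have s1: "?f summable_on range int"
    using s by (subst summable_on_reindex) (auto simp: o_def)
  have s2: "?f summable_on range (\<lambda>n. - int n)"
    using s sym by (subst summable_on_reindex) (auto simp: o_def inj_on_def)
  have "z \<in> range int \<union> range (\<lambda>n. - int n)" for z
    by (cases z rule: int_cases2) auto
  then have U: "range int \<union> range (\<lambda>n. - int n) = UNIV" by blast
  show ?thesis using summable_on_union[OF s1 s2] unfolding U .
qed

text \<open>Submultiplicativity along the coordinate axes bounds \<open>g n\<close> by the product
  of \<open>g\<close> at the axis components, and the exponential of the \<open>l^1\<close> length
  factors as well. So every finite sum is at most a product of one-dimensional sums.\<close>

lemma weight_exp_summable:
  fixes g :: "int ^ 'c::finite \<Rightarrow> real"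
  assumes g: "weight g" and d: "0 < \<delta>"
  shows "(\<lambda>n. g n * exp (- \<delta> * (\<Sum>i\<in>UNIV. \<bar>real_of_int (n $ i)\<bar>))) summable_on UNIV"
proof -
  have g0: "0 < g m" for m using g by (simp add: weight_def)
  define f where "f i z = g (z *s axis i 1) * exp (- \<delta> * \<bar>real_of_int z\<bar>)" for i :: 'c and z :: int
  have fs: "f i summable_on UNIV" for i unfolding f_def by (rule weight_exp_summable_int[OF assms])
  have f0: "0 \<le> f i z" for i z unfolding f_def using g0 by (simp add: less_imp_le)
  have gs: "g (\<Sum>i\<in>I. t i) \<le> (\<Prod>i\<in>I. g (t i))" if "finite I" for I :: "'c set" and t
    using that
  proof (induction I)
    case (insert i I)
    have "g (t i + sum t I) \<le> g (t i) * g (sum t I)" using g by (simp add: weight_def)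
    also have "\<dots> \<le> g (t i) * (\<Prod>i\<in>I. g (t i))"
      using insert g0[of "t i"] by (intro mult_left_mono) auto
    finally show ?case using insert by simp
  qed (use g in \<open>simp add: weight_def\<close>)
  have dec: "(\<Sum>i\<in>UNIV. (n $ i) *s axis i 1) = n" for n :: "int ^ 'c"
    by (simp add: basis_expansion)
  have le: "g n * exp (- \<delta> * (\<Sum>i\<in>UNIV. \<bar>real_of_int (n $ i)\<bar>)) \<le> (\<Prod>i\<in>UNIV. f i (n $ i))" for n
  proof -
    have "g n \<le> (\<Prod>i\<in>UNIV. g ((n $ i) *s axis i 1))"
      using gs[of UNIV "\<lambda>i. (n $ i) *s axis i 1"] dec[of n] by simp
    then show ?thesis
      by (simp add: f_def prod.distrib sum_distrib_left exp_sum mult_right_mono prod_nonneg)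
  qed
  show ?thesis
  proof (rule summable_of_finite_bounds)
    fix A :: "(int ^ 'c) set" assume A: "finite A"
    let ?B = "\<lambda>i. (\<lambda>n. n $ i) ` A"
    \<comment> \<open>The finite set \<open>A\<close> is embedded in the box of its coordinate
      projections, over which a sum of products is a product of sums.\<close>
    have inj: "inj_on (\<lambda>n. \<lambda>i. n $ i) A" by (auto simp: inj_on_def vec_eq_iff fun_eq_iff)
    have "(\<Sum>n\<in>A. g n * exp (- \<delta> * (\<Sum>i\<in>UNIV. \<bar>real_of_int (n $ i)\<bar>)))
        \<le> (\<Sum>n\<in>A. \<Prod>i\<in>UNIV. f i (n $ i))"
      by (rule sum_mono[OF le])
    also have "\<dots> = (\<Sum>h\<in>(\<lambda>n. \<lambda>i. n $ i) ` A. \<Prod>i\<in>UNIV. f i (h i))"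
      by (simp add: sum.reindex[OF inj])
    also have "\<dots> \<le> (\<Sum>h\<in>PiE UNIV ?B. \<Prod>i\<in>UNIV. f i (h i))"
      using A by (intro sum_mono2 finite_PiE prod_nonneg) (auto simp: f0)
    also have "\<dots> = (\<Prod>i\<in>UNIV. \<Sum>z\<in>?B i. f i z)"
      using A by (intro prod_sum_PiE[symmetric]) auto
    also have "\<dots> \<le> (\<Prod>i\<in>UNIV. infsum (f i) UNIV)"
      using A f0 by (intro prod_mono conjI sum_nonneg finite_sum_le_infsum[OF fs]) auto
    finally show "(\<Sum>n\<in>A. g n * exp (- \<delta> * (\<Sum>i\<in>UNIV. \<bar>real_of_int (n $ i)\<bar>)))
      \<le> (\<Prod>i\<in>UNIV. infsum (f i) UNIV)" .
  qed (use g0 in \<open>auto intro: less_imp_le\<close>)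
qed

section \<open>Off-diagonal decay of inverses\<close>

definition norm1 :: "int ^ 'c::finite \<Rightarrow> real" where
  "norm1 n = (\<Sum>i\<in>UNIV. \<bar>real_of_int (n $ i)\<bar>)"

lemma norm1_triangle: "norm1 (m + n) \<le> norm1 m + norm1 n"
  unfolding norm1_def sum.distrib[symmetric] by (intro sum_mono) auto

lemma norm1_minus: "norm1 (- n) = norm1 n"
  by (simp add: norm1_def)

lemma norm1_nonneg: "0 \<le> norm1 n"
  by (simp add: norm1_def sum_nonneg)

text \<open>The weight is positive and, for nonnegative \<open>\<delta>\<close>, at most 1:
  multiplication by it, or by a translate, keeps a family in \<open>lp p\<close>. Hence the
  localised norms below are finite from the start.\<close>

definition wexp :: "real \<Rightarrow> int ^ 'c::finite \<Rightarrow> real" where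
  "wexp \<delta> n = exp (- \<delta> * norm1 n)"

lemma wexp_pos: "0 < wexp \<delta> n"
  by (simp add: wexp_def)

lemma wexp_le_1: "0 \<le> \<delta> \<Longrightarrow> wexp \<delta> n \<le> 1"
  by (simp add: wexp_def norm1_nonneg)

lemma wexp_commute: "wexp \<delta> (m - n) = wexp \<delta> (n - m)"
  using norm1_minus[of "m - n"] by (simp add: wexp_def)

text \<open>The triangle inequality puts the ratio of the two values between
  \<open>exp (- t)\<close> and \<open>exp t\<close> with \<open>t = \<delta> * norm1 m\<close>. The
  factor \<open>exp t - 1\<close> tends to 0 with \<open>\<delta>\<close> for each \<open>m\<close>,
  which makes the commutator small on finitely many diagonals.\<close>

lemma wexp_diff:
  assumes "0 \<le> \<delta>"
  shows "\<bar>wexp \<delta> (n - m) - wexp \<delta> n\<bar> \<le> (exp (\<delta> * norm1 m) - 1) * wexp \<delta> (n - m)"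
proof -
  define t where "t = \<delta> * norm1 m"
  have "norm1 (n - m) \<le> norm1 n + norm1 m" "norm1 n \<le> norm1 (n - m) + norm1 m"
    using norm1_triangle[of n "- m"] norm1_triangle[of "n - m" m] by (simp_all add: norm1_minus)
  then have "\<delta> * norm1 (n - m) \<le> \<delta> * norm1 n + t" "\<delta> * norm1 n \<le> \<delta> * norm1 (n - m) + t"
    using assms by (auto simp: t_def distrib_left[symmetric] intro: mult_left_mono)
  then have a: "wexp \<delta> n \<le> exp t * wexp \<delta> (n - m)" and b: "exp (- t) * wexp \<delta> (n - m) \<le> wexp \<delta> n"
    by (simp_all add: wexp_def exp_add[symmetric])
  \<comment> \<open>The lower deviation is no larger than the upper one, because
    \<open>exp t + exp (- t) \<ge> 2\<close>.\<close>
  have "1 - exp (- t) \<le> exp t - 1"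
    using exp_ge_add_one_self[of t] exp_ge_add_one_self[of "- t"] by linarith
  then have "(1 - exp (- t)) * wexp \<delta> (n - m) \<le> (exp t - 1) * wexp \<delta> (n - m)"
    by (rule mult_right_mono) (simp add: wexp_pos less_imp_le)
  then show ?thesis using a b unfolding t_def[symmetric] by (simp add: algebra_simps abs_le_iff)
qed

lemma weight_wexp_summable:
  assumes "weight g" "0 < \<delta>"
  shows "(\<lambda>n. g n * wexp \<delta> n) summable_on UNIV"
  using weight_exp_summable[OF assms] by (simp add: wexp_def norm1_def)

lemma has_sum_diff:
  fixes f h :: "'i \<Rightarrow> 'b::real_normed_vector"
  assumes "(f has_sum a) A" "(h has_sum b) A"
  shows "((\<lambda>x. f x - h x) has_sum (a - b)) A"
proof -
  have "((\<lambda>x. - h x) has_sum - b) A" using assms(2) by (simp add: has_sum_uminus)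
  then show ?thesis using has_sum_add[OF assms(1)] by fastforce
qed

text \<open>The tail is kept as a function on the whole group that vanishes on \<open>F\<close>, so
  that it can serve as a convolution kernel.\<close>

lemma infsum_small_tail:
  fixes f :: "'g \<Rightarrow> real"
  assumes "f summable_on UNIV" "\<And>m. 0 \<le> f m" "0 < r"
  obtains F where "finite F" "(\<lambda>m. if m \<in> F then 0 else f m) summable_on UNIV"
    "(\<Sum>\<^sub>\<infinity>m. if m \<in> F then 0 else f m) \<le> r"
proof -
  obtain F where F: "finite F" "dist (sum f F) (infsum f UNIV) \<le> r"
    using infsum_finite_approximation[OF assms(1,3)] by blast
  have s: "(\<lambda>m. if m \<in> F then f m else 0) summable_on UNIV"
    by (rule summable_on_comparison_test[OF assms(1)]) (use assms(2) in auto)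
  have i: "(\<Sum>\<^sub>\<infinity>m. if m \<in> F then f m else 0) = sum f F"
    by (intro infsumI has_sum_finite_neutralI[where B = F]) (use F(1) in auto)
  have s2: "(\<lambda>m. if m \<in> F then 0 else f m) summable_on UNIV"
    by (rule summable_on_comparison_test[OF assms(1)]) (use assms(2) in auto)
  have "infsum f UNIV = (\<Sum>\<^sub>\<infinity>m. (if m \<in> F then f m else 0) + (if m \<in> F then 0 else f m))"
    by (intro infsum_cong) auto
  also have "\<dots> = sum f F + (\<Sum>\<^sub>\<infinity>m. if m \<in> F then 0 else f m)"
    by (subst infsum_add[OF s s2]) (simp add: i)
  finally show ?thesis using that[OF F(1) s2] F(2) by (simp add: dist_real_def)
qed

text \<open>The \<open>l_p\<close> norm is dominated by the \<open>l^1\<close> norm, and for the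
  localised family the latter is exactly a convolution with \<open>wexp \<delta>\<close>.\<close>

lemma lp_le_l1_weighted:
  fixes x :: "int ^ 'c::finite \<Rightarrow> 'a::real_normed_vector"
  assumes p: "1 \<le> p" and x: "x \<in> lp p" and d: "0 < \<delta>" and w: "wexp \<delta> summable_on (UNIV :: (int ^ 'c) set)"
  shows "(\<lambda>k. wexp \<delta> (k - j) * norm (x k)) \<in> lp p"
    "lpnorm p (\<lambda>k. wexp \<delta> (k - j) * norm (x k)) \<le> conv (wexp \<delta>) (\<lambda>k. norm (x k)) j"
proof -
  let ?a = "\<lambda>k. wexp \<delta> (k - j) * norm (x k)"
  have w0: "0 \<le> wexp \<delta> n" for n :: "int ^ 'c" by (simp add: wexp_pos less_imp_le)
  show lp: "?a \<in> lp p"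
    by (rule lp_mono(1)[OF p x])
      (use wexp_le_1[of \<delta>] d in \<open>auto simp: abs_mult wexp_pos less_imp_le intro!: mult_left_le_one_le\<close>)
  have c: "(\<Sum>\<^sub>\<infinity>l. ?a l) = conv (wexp \<delta>) (\<lambda>k. norm (x k)) j"
    unfolding conv_def
    by (rule infsum_reindex_bij_witness[of _ "\<lambda>m. j - m" "\<lambda>l. j - l"])
      (auto simp: wexp_commute[of \<delta> j])
  have cs: "(\<lambda>m. wexp \<delta> m * norm (x (j - m))) summable_on UNIV"
    by (rule conv_bounded_summable[where U = "lpnorm p x"]) (use w w0 norm_le_lpnorm[OF p x] in auto)
  have s: "?a summable_on UNIV"
    using cs
    by (subst summable_on_reindex_bij_witness[of _ "\<lambda>m. j - m" "\<lambda>l. j - l" _ "\<lambda>m. wexp \<delta> m * norm (x (j - m))"])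
      (auto simp: wexp_commute[of \<delta> j])
  \<comment> \<open>The family is the sum of its one-point pieces, each with norm at most its only
    value; \<open>lp_infsum\<close> adds these up.\<close>
  let ?A = "\<lambda>l k. if k = l then ?a l else 0"
  have sng: "(\<Sum>\<^sub>\<infinity>l. ?A l k) = ?a k" for k
  proof -
    have "((\<lambda>l. ?A l k) has_sum ?a k) UNIV"
      by (rule has_sum_finite_neutralI[where B = "{k}"]) auto
    then show ?thesis by (rule infsumI)
  qed
  have "lpnorm p ?a \<le> (\<Sum>\<^sub>\<infinity>l. ?a l)"
  proof (rule lp_infsum(2)[OF p, where a = ?A])
    show "?A l \<in> lp p" for l by (rule lp_single(1)[OF p])
    show "lpnorm p (?A l) \<le> ?a l" for l
      using lp_single(2)[OF p, where l = l and v = "?a l"] w0 by simp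
    show "norm (?a k) \<le> (\<Sum>\<^sub>\<infinity>l. ?A l k)" for k unfolding sng using w0 by simp
  qed (use w0 s in auto)
  then show "lpnorm p ?a \<le> conv (wexp \<delta>) (\<lambda>k. norm (x k)) j" unfolding c .
qed

text \<open>Of the entries of \<open>S\<close> only norm bounds and real homogeneity enter, the
  weights being real scalars. The conclusion is a pointwise domination, from which entry bounds and
  convergence of the matrix of \<open>R\<close> are both read off later.\<close>

lemma inverse_localized:
  fixes g :: "int ^ 'c::finite \<Rightarrow> real" and s :: "int ^ 'c \<Rightarrow> int ^ 'c \<Rightarrow> 'a::real_normed_vector \<Rightarrow> 'a"
    and S R :: "(int ^ 'c \<Rightarrow> 'a) \<Rightarrow> (int ^ 'c \<Rightarrow> 'a)"
  assumes p: "1 \<le> p" and gw: "weight g"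
    and bs: "(\<lambda>m. g m * \<beta> m) summable_on UNIV" and b0: "\<And>m. 0 \<le> \<beta> m"
    and sb: "\<And>k m v. norm (s k m v) \<le> \<beta> m * norm v"
    and ss: "\<And>k m r v. s k m (r *\<^sub>R v) = r *\<^sub>R s k m v"
    and Ssum: "\<And>x k. x \<in> lp p \<Longrightarrow> ((\<lambda>m. s k m (x (k - m))) has_sum S x k) UNIV"
    and Slp: "\<And>x. x \<in> lp p \<Longrightarrow> S x \<in> lp p" and Rlp: "\<And>x. x \<in> lp p \<Longrightarrow> R x \<in> lp p"
    and RS: "\<And>x. x \<in> lp p \<Longrightarrow> R (S x) = x" and SR: "\<And>x. x \<in> lp p \<Longrightarrow> S (R x) = x"
    and Rb: "\<And>x. x \<in> lp p \<Longrightarrow> lpnorm p (R x) \<le> K0 * lpnorm p x"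
  obtains \<beta>' where "(\<lambda>m. g m * \<beta>' m) summable_on UNIV" "\<And>m. 0 \<le> \<beta>' m"
    "\<And>x j. x \<in> lp p \<Longrightarrow> norm (R x j) \<le> conv \<beta>' (\<lambda>k. norm (x k)) j"
proof -
  have g1: "1 \<le> g m" and gm: "g (m + n) \<le> g m * g n" for m n using gw by (auto simp: weight_def)
  have g0: "0 \<le> g m" for m using g1[of m] by linarith
  define K where "K = max K0 1"
  have K: "0 < K" "1 \<le> K" by (auto simp: K_def)
  have RK: "lpnorm p (R x) \<le> K * lpnorm p x" if "x \<in> lp p" for x
  proof -
    have "K0 * lpnorm p x \<le> K * lpnorm p x"
      using lpnorm_nonneg[OF that] by (intro mult_right_mono) (auto simp: K_def)
    then show ?thesis using Rb[OF that] by linarith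
  qed
  define C where "C = infsum \<beta> UNIV"
  note bs1 = summable_of_weighted(1)[OF g1 bs b0]
  have C0: "0 \<le> C" unfolding C_def using b0 by (simp add: infsum_nonneg)
  \<comment> \<open>With this threshold the kernel \<open>2 * K * e\<close> of the tail has
    \<open>g\<close>-mass at most 1/2, as \<open>conv_resolvent_bound\<close> requires.\<close>
  obtain F where F: "finite F" "(\<lambda>m. if m \<in> F then 0 else g m * \<beta> m) summable_on UNIV"
      "(\<Sum>\<^sub>\<infinity>m. if m \<in> F then 0 else g m * \<beta> m) \<le> 1 / (4 * K)"
    by (rule infsum_small_tail[OF bs, of "1 / (4 * K)"]) (use g0 b0 K in auto)
  define e where "e m = (if m \<in> F then 0 else \<beta> m)" for m
  have e0: "0 \<le> e m" for m by (simp add: e_def b0)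
  have ge: "g m * e m = (if m \<in> F then 0 else g m * \<beta> m)" for m by (simp add: e_def)
  have es: "(\<lambda>m. g m * e m) summable_on UNIV" "(\<Sum>\<^sub>\<infinity>m. g m * e m) \<le> 1 / (4 * K)"
    unfolding ge using F by auto
  note es1 = summable_of_weighted[OF g1 es(1) e0]
  \<comment> \<open>Chosen so that \<open>\<eta> * C \<le> 1 / (4 * K)\<close>; the added 1 guards
    against \<open>C = 0\<close>.\<close>
  define \<eta> where "\<eta> = 1 / (4 * K * (C + 1))"
  have \<eta>: "0 < \<eta>" using K C0 by (simp add: \<eta>_def)
  \<comment> \<open>A bound for \<open>norm1\<close> on \<open>F\<close> that stays positive when
    \<open>F\<close> is empty or consists of the origin.\<close>
  define M where "M = sum norm1 F + 1"
  have M: "0 < M" unfolding M_def using sum_nonneg[of F norm1] norm1_nonneg by (smt (verit))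
  \<comment> \<open>Solves \<open>exp (\<delta> * M) = 1 + \<eta>\<close>: on the diagonals in
    \<open>F\<close> the weight then has relative variation at most \<open>\<eta>\<close>.\<close>
  define \<delta> where "\<delta> = ln (1 + \<eta>) / M"
  have \<delta>: "0 < \<delta>" using \<eta> M by (simp add: \<delta>_def)
  have \<delta>F: "exp (\<delta> * norm1 m) - 1 \<le> \<eta>" if "m \<in> F" for m
  proof -
    have "norm1 m \<le> M" unfolding M_def
      using member_le_sum[of m F norm1] that F(1) norm1_nonneg by (smt (verit))
    then have "\<delta> * norm1 m \<le> \<delta> * M" using \<delta> by (intro mult_left_mono) auto
    also have "\<dots> = ln (1 + \<eta>)" using M by (simp add: \<delta>_def)
    finally have "exp (\<delta> * norm1 m) \<le> exp (ln (1 + \<eta>))" by (simp only: exp_le_cancel_iff)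
    then show ?thesis using \<eta> by simp
  qed
  let ?w = "wexp \<delta> :: int ^ 'c \<Rightarrow> real"
  have w0: "0 \<le> ?w n" and w1: "?w n \<le> 1" for n using wexp_pos[of \<delta> n] wexp_le_1[of \<delta> n] \<delta> by auto
  note ws = weight_wexp_summable[OF gw \<delta>]
  note ws1 = summable_of_weighted(1)[OF g1 ws w0]
  \<comment> \<open>The part of the commutator that is measured against the localised family itself.
    Its mass is at most \<open>1 / (2 * K)\<close>, hence it can be absorbed into the left-hand
    side.\<close>
  define c where "c m = \<eta> * \<beta> m + e m" for m
  have c0: "0 \<le> c m" for m unfolding c_def using \<eta> b0 e0 by (simp add: less_imp_le)
  have cs: "c summable_on UNIV"
    unfolding c_def[abs_def] by (intro summable_on_add summable_on_cmult_right bs1 es1)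
  have "infsum c UNIV = \<eta> * C + infsum e UNIV"
    unfolding c_def[abs_def] C_def
    by (subst infsum_add) (auto intro!: summable_on_cmult_right bs1 es1 simp: infsum_cmult_right')
  also have "\<dots> \<le> 1 / (4 * K) + 1 / (4 * K)"
  proof (intro add_mono)
    have "\<eta> * C = C / (C + 1) * (1 / (4 * K))" by (simp add: \<eta>_def)
    also have "\<dots> \<le> 1 * (1 / (4 * K))" using K C0 by (intro mult_right_mono) (auto simp: field_simps)
    finally show "\<eta> * C \<le> 1 / (4 * K)" by simp
    show "infsum e UNIV \<le> 1 / (4 * K)" using es1(2) es(2) by linarith
  qed
  finally have cK: "K * infsum c UNIV \<le> 1 / 2" using K by (simp add: field_simps)
  \<comment> \<open>The factor 2 arises in \<open>rec\<close> below, when half of \<open>h i\<close>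
    is moved to the left.\<close>
  have "g m * (2 * K * e m) = 2 * K * (g m * e m)" for m by simp
  then have E: "(\<lambda>m. g m * (2 * K * e m)) summable_on UNIV" "(\<Sum>\<^sub>\<infinity>m. g m * (2 * K * e m)) \<le> 1 / 2"
    using summable_on_cmult_right[OF es(1), of "2 * K"] mult_left_mono[OF es(2), of "2 * K"] K
    by (simp_all only: infsum_cmult_right') auto
  have "g m * (2 * K * ?w m) = 2 * K * (g m * ?w m)" for m by simp
  then have W: "(\<lambda>m. g m * (2 * K * ?w m)) summable_on UNIV"
    using summable_on_cmult_right[OF ws, of "2 * K"] by (simp only:)
  obtain \<beta>' where \<beta>': "(\<lambda>m. g m * \<beta>' m) summable_on UNIV" "\<And>m. 0 \<le> \<beta>' m"
    "\<And>h u H U j. \<lbrakk>\<And>i. 0 \<le> u i; \<And>i. u i \<le> U; \<And>i. 0 \<le> h i; \<And>i. h i \<le> H;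
       \<And>i. h i \<le> conv (\<lambda>m. 2 * K * ?w m) u i + conv (\<lambda>m. 2 * K * e m) h i\<rbrakk> \<Longrightarrow> h j \<le> conv \<beta>' u j"
    by (rule conv_resolvent_bound[OF g1 gm E(1) _ E(2) W]) (use K e0 w0 in auto)
  have main: "norm (R x j) \<le> conv \<beta>' (\<lambda>k. norm (x k)) j" if x: "x \<in> lp p" for x j
  proof -
    define y where "y = R x"
    have y: "y \<in> lp p" and Sy: "S y = x" using Rlp SR x by (auto simp: y_def)
    define Y where "Y i k = ?w (k - i) *\<^sub>R y k" for i k
    define h where "h i = lpnorm p (Y i)" for i
    have nY: "norm (Y i k) = ?w (k - i) * norm (y k)" for i k by (simp add: Y_def w0)
    have Yle: "norm (Y i k) \<le> norm (y k)" for i k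
      unfolding nY using w0 w1 by (intro mult_left_le_one_le) auto
    have Y: "Y i \<in> lp p" "h i \<le> lpnorm p y" for i
      unfolding h_def by (rule lp_mono[OF p y Yle])+
    have h0: "0 \<le> h i" for i unfolding h_def by (rule lpnorm_nonneg[OF Y(1)])
    have rec: "h i \<le> 2 * K * conv ?w (\<lambda>k. norm (x k)) i + 2 * K * conv e h i" for i
    proof -
      \<comment> \<open>Three majorants for \<open>S (Y i)\<close>: the localised datum, the
        absorbable part of the commutator, and the far diagonals, where the weight stays at
        \<open>k\<close> while \<open>y\<close> is taken at \<open>k - m\<close>.\<close>
      define a1 where "a1 k = ?w (k - i) * norm (x k)" for k
      define a2 where "a2 k = (\<Sum>\<^sub>\<infinity>m. c m * norm (Y i (k - m)))" for k
      define a3 where "a3 k = (\<Sum>\<^sub>\<infinity>m. e m * (?w (k - i) * norm (y (k - m))))" for k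
      have s2: "(\<lambda>m. c m * norm (Y i (k - m))) summable_on UNIV" for k
        by (rule conv_bounded_summable[where U = "lpnorm p (Y i)"])
          (use cs c0 norm_le_lpnorm[OF p Y(1)] in auto)
      have s3: "(\<lambda>m. e m * (?w (k - i) * norm (y (k - m)))) summable_on UNIV" for k
        by (rule conv_bounded_summable[where U = "?w (k - i) * lpnorm p y" and u = "\<lambda>l. ?w (k - i) * norm (y l)"])
          (use es1 e0 norm_le_lpnorm[OF p y] w0 in \<open>auto simp: abs_mult intro: mult_left_mono\<close>)
      have a1: "a1 \<in> lp p" "lpnorm p a1 \<le> conv ?w (\<lambda>k. norm (x k)) i"
        unfolding a1_def[abs_def] by (rule lp_le_l1_weighted[OF p x \<delta> ws1])+
      have A2: "(\<lambda>k. c m * norm (Y i (k - m))) \<in> lp p \<and>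
          lpnorm p (\<lambda>k. c m * norm (Y i (k - m))) \<le> c m * h i" for m
        using lp_scale[OF p lp_translate(1)[OF Y(1)[of i], of m] c0[of m], of "\<lambda>k. c m * norm (Y i (k - m))"]
          lp_translate(2)[OF Y(1)[of i], of m] c0[of m]
        by (simp add: h_def)
      have a2: "a2 \<in> lp p" "lpnorm p a2 \<le> (\<Sum>\<^sub>\<infinity>m. c m * h i)"
        using lp_infsum[OF p, of "\<lambda>m k. c m * norm (Y i (k - m))" "\<lambda>m. c m * h i" a2]
          A2 c0 summable_on_cmult_left[OF cs, of "h i"]
        by (auto simp: a2_def infsum_nonneg)
      have A3: "(\<lambda>k. e m * (?w (k - i) * norm (y (k - m)))) \<in> lp p \<and>
          lpnorm p (\<lambda>k. e m * (?w (k - i) * norm (y (k - m)))) \<le> e m * h (i - m)" for m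
      proof -
        \<comment> \<open>Since \<open>k - i = (k - m) - (i - m)\<close>, the far term is a
          translate of the family localised at \<open>i - m\<close>. This is what produces the
          convolution of \<open>e\<close> with \<open>h\<close>.\<close>
        have "norm (Y (i - m) (k - m)) = ?w (k - i) * norm (y (k - m))" for k
          unfolding nY by simp
        then show ?thesis
          using lp_scale[OF p lp_translate(1)[OF Y(1)[of "i - m"], of m] e0[of m],
              of "\<lambda>k. e m * (?w (k - i) * norm (y (k - m)))"]
            lp_translate(2)[OF Y(1)[of "i - m"], of m] e0[of m] w0
          by (simp add: h_def)
      qed
      have he: "(\<lambda>m. e m * h (i - m)) summable_on UNIV"
        by (rule conv_bounded_summable[where U = "lpnorm p y"]) (use es1 e0 h0 Y(2) in auto)
      have a3: "a3 \<in> lp p" "lpnorm p a3 \<le> conv e h i"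
        using lp_infsum[OF p, of "\<lambda>m k. e m * (?w (k - i) * norm (y (k - m)))" "\<lambda>m. e m * h (i - m)" a3]
          A3 e0 w0 he
        by (auto simp: a3_def infsum_nonneg conv_def)
      have a0: "0 \<le> a1 k" "0 \<le> a2 k" "0 \<le> a3 k" for k
        by (auto simp: a1_def a2_def a3_def w0 c0 e0 intro!: infsum_nonneg)
      have a23: "(\<lambda>k. a2 k + a3 k) \<in> lp p" "lpnorm p (\<lambda>k. a2 k + a3 k) \<le> lpnorm p a2 + lpnorm p a3"
        using lp_triangle[OF p a2(1) a3(1), of "\<lambda>k. a2 k + a3 k"] by auto
      have pt: "norm (S (Y i) k) \<le> norm (a1 k) + norm (a2 k + a3 k)" for k
      proof -
        \<comment> \<open>On diagonals in \<open>F\<close> the weight varies slowly; elsewhere the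
          difference of the two weights is bounded by their sum, one summand going to
          \<open>c\<close> and the other to \<open>e\<close>.\<close>
        have tb: "norm (s k m (Y i (k - m)) - ?w (k - i) *\<^sub>R s k m (y (k - m)))
            \<le> c m * norm (Y i (k - m)) + e m * (?w (k - i) * norm (y (k - m)))" for m
        proof -
          let ?D = "\<bar>?w (k - i - m) - ?w (k - i)\<bar>"
          have r: "k - m - i = k - i - m" by simp
          have "s k m (Y i (k - m)) - ?w (k - i) *\<^sub>R s k m (y (k - m)) =
              (?w (k - i - m) - ?w (k - i)) *\<^sub>R s k m (y (k - m))"
            unfolding Y_def ss r by (simp add: scaleR_left_diff_distrib)
          then have "norm (s k m (Y i (k - m)) - ?w (k - i) *\<^sub>R s k m (y (k - m)))
              \<le> ?D * (\<beta> m * norm (y (k - m)))"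
            using sb by (simp add: mult_left_mono)
          also have "\<dots> \<le> c m * norm (Y i (k - m)) + e m * (?w (k - i) * norm (y (k - m)))"
          proof (cases "m \<in> F")
            case True
            have "?D \<le> \<eta> * ?w (k - i - m)"
              using wexp_diff[of \<delta> "k - i" m] \<delta> mult_right_mono[OF \<delta>F[OF True] w0[of "k - i - m"]] by linarith
            then have "?D * (\<beta> m * norm (y (k - m))) \<le> \<eta> * ?w (k - i - m) * (\<beta> m * norm (y (k - m)))"
              using b0 by (intro mult_right_mono) auto
            then show ?thesis using True unfolding nY r by (simp add: c_def e_def ac_simps)
          next
            case False
            have "?D \<le> ?w (k - i - m) + ?w (k - i)" using w0[of "k - i - m"] w0[of "k - i"] by linarith
            then have "?D * (\<beta> m * norm (y (k - m))) \<le> (?w (k - i - m) + ?w (k - i)) * (\<beta> m * norm (y (k - m)))"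
              using b0 by (intro mult_right_mono) auto
            moreover have "0 \<le> \<eta> * \<beta> m * (?w (k - i - m) * norm (y (k - m)))"
              using \<eta> b0 w0 by (simp add: less_imp_le)
            ultimately show ?thesis using False unfolding nY r by (simp add: c_def e_def algebra_simps)
          qed
          finally show ?thesis .
        qed
        \<comment> \<open>As \<open>x = S y\<close>, this series is the commutator of
          \<open>S\<close> with the weight, applied to \<open>y\<close>.\<close>
        have D: "((\<lambda>m. s k m (Y i (k - m)) - ?w (k - i) *\<^sub>R s k m (y (k - m))) has_sum
            (S (Y i) k - ?w (k - i) *\<^sub>R x k)) UNIV"
          unfolding Sy[symmetric]
          by (intro has_sum_diff has_sum_scaleR Ssum Y y)
        have S23: "((\<lambda>m. c m * norm (Y i (k - m)) + e m * (?w (k - i) * norm (y (k - m)))) has_sum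
            (a2 k + a3 k)) UNIV"
          unfolding a2_def a3_def by (intro has_sum_add has_sum_infsum s2 s3)
        have "norm (S (Y i) k - ?w (k - i) *\<^sub>R x k) \<le> a2 k + a3 k"
          using norm_infsum_le[OF D S23] tb by simp
        moreover have "norm (?w (k - i) *\<^sub>R x k) = a1 k" by (simp add: a1_def w0)
        ultimately show ?thesis
          using norm_triangle_sub[of "S (Y i) k" "?w (k - i) *\<^sub>R x k"] a0[of k] by simp
      qed
      \<comment> \<open>The a priori bound: \<open>Y i = R (S (Y i))\<close>, so its norm is
        controlled by that of \<open>S (Y i)\<close>.\<close>
      have "h i \<le> K * lpnorm p (S (Y i))"
        using RK[OF Slp[OF Y(1)[of i]]] RS[OF Y(1)[of i]] by (simp add: h_def)
      also have "\<dots> \<le> K * (conv ?w (\<lambda>k. norm (x k)) i + infsum c UNIV * h i + conv e h i)"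
        using lp_triangle(2)[OF p a1(1) a23(1) pt] a1(2) a23(2) a2(2) a3(2) K
        by (intro mult_left_mono) (auto simp: infsum_cmult_left')
      finally have "h i \<le> K * conv ?w (\<lambda>k. norm (x k)) i + (K * infsum c UNIV) * h i + K * conv e h i"
        by (simp add: algebra_simps)
      moreover have "(K * infsum c UNIV) * h i \<le> 1 / 2 * h i"
        by (rule mult_right_mono[OF cK h0])
      ultimately show ?thesis by simp
    qed
    have "h j \<le> conv \<beta>' (\<lambda>k. norm (x k)) j"
    proof (rule \<beta>'(3))
      show "norm (x k) \<le> lpnorm p x" for k by (rule norm_le_lpnorm[OF p x])
      show "h i \<le> conv (\<lambda>m. 2 * K * ?w m) (\<lambda>k. norm (x k)) i + conv (\<lambda>m. 2 * K * e m) h i" for i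
        using rec[of i] unfolding conv_def by (simp add: infsum_cmult_right' mult.assoc)
    qed (use Y(2) h0 in auto)
    \<comment> \<open>The weight centred at \<open>j\<close> equals 1 at \<open>j\<close>, so
      \<open>Y j\<close> and \<open>R x\<close> agree there.\<close>
    moreover have "norm (R x j) \<le> h j"
      using norm_le_lpnorm[OF p Y(1)[of j], of j] by (simp add: h_def Y_def wexp_def norm1_def y_def)
    ultimately show ?thesis by linarith
  qed
  show ?thesis by (rule that[OF \<beta>'(1,2) main])
qed

section \<open>Nuclear operators\<close>

lemma cscale_add_right: "linear J \<Longrightarrow> cscale J z (x + y) = cscale J z x + cscale J z y"
  by (simp add: cscale_def linear_add algebra_simps)

lemma cscale_diff_right: "linear J \<Longrightarrow> cscale J z (x - y) = cscale J z x - cscale J z y"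
  by (simp add: cscale_def linear_diff algebra_simps)

lemma cscale_sum_left: "cscale J (\<Sum>i\<in>I. f i) x = (\<Sum>i\<in>I. cscale J (f i) x)"
  by (simp add: cscale_def scaleR_sum_left sum.distrib)

lemma cscale_cscale:
  assumes "complex_banach J"
  shows "cscale J z (cscale J w x) = cscale J (z * w) x"
proof -
  have l: "linear J" and J: "J (J y) = - y" for y using assms by (auto simp: complex_banach_def)
  show ?thesis
    by (simp add: cscale_def linear_add[OF l] linear_scale[OF l] J algebra_simps)
qed

lemma cscale_of_real: "cscale J (of_real r) x = r *\<^sub>R x"
  by (simp add: cscale_def)

lemma cscale_ii: "cscale J \<i> x = J x"
  by (simp add: cscale_def)

lemma cscale_zero_right: "linear J \<Longrightarrow> cscale J z 0 = 0"
  by (simp add: cscale_def linear_0)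

lemma norm_cscale: "complex_banach J \<Longrightarrow> norm (cscale J z x) = cmod z * norm x"
  by (simp add: complex_banach_def)

lemma clin_cscale: "clin J1 J2 f \<Longrightarrow> f (cscale J1 z x) = cscale J2 z (f x)"
  by (simp add: clin_def cscale_def linear_add linear_scale)

lemma clinI:
  assumes "\<And>x y. f (x + y) = f x + f y" "\<And>z x. f (cscale J1 z x) = cscale J2 z (f x)"
  shows "clin J1 J2 f"
  unfolding clin_def
proof (intro conjI allI linearI assms)
  show "f (r *\<^sub>R x) = r *\<^sub>R f x" for r x
    using assms(2)[of "of_real r" x] by (simp add: cscale_of_real)
  show "f (J1 x) = J2 (f x)" for x
    using assms(2)[of \<i> x] by (simp add: cscale_ii)
qed

lemma clin_cscale_op:
  assumes "complex_banach J"
  shows "clin J J (cscale J z)"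
proof (rule clinI)
  show "cscale J z (x + y) = cscale J z x + cscale J z y" for x y
    using assms by (simp add: cscale_add_right complex_banach_def)
  show "cscale J z (cscale J w x) = cscale J w (cscale J z x)" for w x
    by (simp add: cscale_cscale[OF assms] mult.commute)
qed

text \<open>A witness in place of the infimum of \<open>nuclear_norm\<close>: one representation of
  total mass at most \<open>s\<close>. Composition and summation can be carried out on
  representations directly.\<close>

definition nuclear_bound :: "('a::banach \<Rightarrow> 'a) \<Rightarrow> ('a \<Rightarrow> 'a) \<Rightarrow> real \<Rightarrow> bool" where
  "nuclear_bound J A s \<longleftrightarrow> (\<exists>a y. nuc_rep J A a y \<and> (\<Sum>i. onorm (a i) * norm (y i)) \<le> s)"

section \<open>Representations of bounded mass and the ideal property\<close>

lemma cdual_bound: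
  assumes "cdual J a"
  shows "cmod (a x) \<le> onorm a * norm x" "0 \<le> onorm a"
  using assms onorm onorm_pos_le by (auto simp: cdual_def)

lemma nuc_rep_term_bound:
  assumes "complex_banach J" "nuc_rep J A a y"
  shows "norm (cscale J (a i x) (y i)) \<le> onorm (a i) * norm (y i) * norm x"
proof -
  have "cmod (a i x) * norm (y i) \<le> onorm (a i) * norm x * norm (y i)"
    using assms cdual_bound(1) by (intro mult_right_mono) (auto simp: nuc_rep_def)
  then show ?thesis by (simp add: norm_cscale[OF assms(1)] ac_simps)
qed

lemma nuclear_bound_norm:
  assumes J: "complex_banach J" and A: "nuclear_bound J A s"
  shows "norm (A x) \<le> s * norm x"
proof -
  obtain a y where r: "nuc_rep J A a y" and s: "(\<Sum>i. onorm (a i) * norm (y i)) \<le> s"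
    using A by (auto simp: nuclear_bound_def)
  have sm: "summable (\<lambda>i. onorm (a i) * norm (y i) * norm x)"
    using r by (intro summable_mult2) (auto simp: nuc_rep_def)
  have "norm (A x) \<le> (\<Sum>i. onorm (a i) * norm (y i) * norm x)"
    using r sums_unique[of "\<lambda>i. cscale J (a i x) (y i)" "A x"]
      norm_suminf_le[OF nuc_rep_term_bound[OF J r] sm] by (simp add: nuc_rep_def)
  also have "\<dots> = (\<Sum>i. onorm (a i) * norm (y i)) * norm x"
    using r by (intro suminf_mult2[symmetric]) (auto simp: nuc_rep_def)
  also have "\<dots> \<le> s * norm x" by (rule mult_right_mono[OF s]) simp
  finally show ?thesis .
qed

lemma nuclear_bound_nonneg:
  assumes "nuclear_bound J A s"
  shows "0 \<le> s"
proof -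
  obtain a y where r: "nuc_rep J A a y" and s: "(\<Sum>i. onorm (a i) * norm (y i)) \<le> s"
    using assms by (auto simp: nuclear_bound_def)
  have "0 \<le> (\<Sum>i. onorm (a i) * norm (y i))"
    using r by (intro suminf_nonneg) (auto simp: nuc_rep_def intro!: mult_nonneg_nonneg cdual_bound(2))
  then show ?thesis using s by linarith
qed

lemma bdd_below_nuclear_sums:
  "bdd_below {(\<Sum>i. onorm (a i) * norm (y i)) | a y. nuc_rep J A a y}"
proof (rule bdd_belowI[of _ 0])
  fix t assume "t \<in> {(\<Sum>i. onorm (a i) * norm (y i)) | a y. nuc_rep J A a y}"
  then have "nuclear_bound J A t" by (auto simp: nuclear_bound_def)
  then show "0 \<le> t" by (rule nuclear_bound_nonneg)
qed

lemma nuclear_of_bound: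
  assumes J: "complex_banach J" and l: "clin J J A" and A: "nuclear_bound J A s"
  shows "nuclear J A" "nuclear_norm J A \<le> s"
proof -
  obtain a y where r: "nuc_rep J A a y" and s: "(\<Sum>i. onorm (a i) * norm (y i)) \<le> s"
    using A by (auto simp: nuclear_bound_def)
  have "bounded_linear A"
    using l nuclear_bound_norm[OF J A]
    by (intro bounded_linear_intro[where K = s])
      (auto simp: clin_def linear_add linear_scale mult.commute)
  then show "nuclear J A" using l r by (auto simp: nuclear_def)
  have "nuclear_norm J A \<le> (\<Sum>i. onorm (a i) * norm (y i))"
    unfolding nuclear_norm_def by (rule cInf_lower[OF _ bdd_below_nuclear_sums]) (use r in auto)
  then show "nuclear_norm J A \<le> s" using s by linarith
qed

lemma nuclear_bound_of_nuclear:
  assumes "nuclear J A" "nuclear_norm J A < s"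
  shows "nuclear_bound J A s"
proof -
  have "{(\<Sum>i. onorm (a i) * norm (y i)) | a y. nuc_rep J A a y} \<noteq> {}"
    using assms(1) by (auto simp: nuclear_def)
  from cInf_lessD[OF this assms(2)[unfolded nuclear_norm_def]]
  show ?thesis by (force simp: nuclear_bound_def)
qed

text \<open>Half of the ideal property: \<open>L\<close> is moved onto the vectors
  \<open>y i\<close>, and the functionals stay.\<close>

lemma nuclear_bound_compose_left:
  assumes J: "complex_banach J" and A: "nuclear_bound J A s"
    and l: "clin J J L" and b: "\<And>v. norm (L v) \<le> c * norm v" and c: "0 \<le> c"
  shows "nuclear_bound J (\<lambda>x. L (A x)) (c * s)"
proof -
  obtain a y where r: "nuc_rep J A a y" and s: "(\<Sum>i. onorm (a i) * norm (y i)) \<le> s"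
    using A by (auto simp: nuclear_bound_def)
  have bl: "bounded_linear L"
    using l b by (intro bounded_linear_intro[where K = c])
      (auto simp: clin_def linear_add linear_scale mult.commute)
  have sm: "summable (\<lambda>i. onorm (a i) * norm (y i))" using r by (simp add: nuc_rep_def)
  have o: "0 \<le> onorm (a i)" for i using r cdual_bound(2) by (auto simp: nuc_rep_def)
  have le: "onorm (a i) * norm (L (y i)) \<le> c * (onorm (a i) * norm (y i))" for i
    using mult_left_mono[OF b[of "y i"] o[of i]] by (simp add: ac_simps)
  have sm': "summable (\<lambda>i. onorm (a i) * norm (L (y i)))"
    by (rule summable_comparison_test'[OF summable_mult[OF sm, of c]]) (use le o in auto)
  have "nuc_rep J (\<lambda>x. L (A x)) a (\<lambda>i. L (y i))"
    using r sm' bounded_linear.sums[OF bl] clin_cscale[OF l, symmetric] by (auto simp: nuc_rep_def)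
  moreover have "(\<Sum>i. onorm (a i) * norm (L (y i))) \<le> c * s"
  proof -
    have "(\<Sum>i. onorm (a i) * norm (L (y i))) \<le> (\<Sum>i. c * (onorm (a i) * norm (y i)))"
      by (rule suminf_le[OF le sm' summable_mult[OF sm]])
    also have "\<dots> = c * (\<Sum>i. onorm (a i) * norm (y i))" by (rule suminf_mult[OF sm])
    also have "\<dots> \<le> c * s" by (rule mult_left_mono[OF s c])
    finally show ?thesis .
  qed
  ultimately show ?thesis by (auto simp: nuclear_bound_def)
qed

text \<open>The other half: the functionals \<open>a i\<close> are composed with \<open>L\<close>,
  and the vectors stay.\<close>

lemma nuclear_bound_compose_right:
  assumes J: "complex_banach J" and A: "nuclear_bound J A s"
    and l: "clin J J L" and b: "\<And>v. norm (L v) \<le> c * norm v" and c: "0 \<le> c"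
  shows "nuclear_bound J (\<lambda>x. A (L x)) (c * s)"
proof -
  obtain a y where r: "nuc_rep J A a y" and s: "(\<Sum>i. onorm (a i) * norm (y i)) \<le> s"
    using A by (auto simp: nuclear_bound_def)
  have bl: "bounded_linear L"
    using l b by (intro bounded_linear_intro[where K = c])
      (auto simp: clin_def linear_add linear_scale mult.commute)
  have sm: "summable (\<lambda>i. onorm (a i) * norm (y i))" using r by (simp add: nuc_rep_def)
  have a: "cdual J (a i)" for i using r by (simp add: nuc_rep_def)
  have aL: "cdual J (\<lambda>x. a i (L x))" for i
    using a[of i] l bounded_linear_compose[of "a i" L] bl
    by (auto simp: cdual_def clin_def bounded_linear.linear)
  have oL: "onorm (\<lambda>x. a i (L x)) \<le> c * onorm (a i)" for i
  proof (rule onorm_bound)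
    show "0 \<le> c * onorm (a i)" using c cdual_bound(2)[OF a] by simp
    show "norm (a i (L x)) \<le> c * onorm (a i) * norm x" for x
      using cdual_bound(1)[OF a, of i "L x"] mult_left_mono[OF b[of x] cdual_bound(2)[OF a[of i]]]
      by (simp add: ac_simps)
  qed
  have le: "onorm (\<lambda>x. a i (L x)) * norm (y i) \<le> c * (onorm (a i) * norm (y i))" for i
    using mult_right_mono[OF oL[of i] norm_ge_zero[of "y i"]] by (simp add: ac_simps)
  have sm': "summable (\<lambda>i. onorm (\<lambda>x. a i (L x)) * norm (y i))"
    by (rule summable_comparison_test'[OF summable_mult[OF sm, of c]])
      (use le cdual_bound(2)[OF aL] in auto)
  have "nuc_rep J (\<lambda>x. A (L x)) (\<lambda>i x. a i (L x)) y"
    using r sm' aL by (auto simp: nuc_rep_def)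
  moreover have "(\<Sum>i. onorm (\<lambda>x. a i (L x)) * norm (y i)) \<le> c * s"
  proof -
    have "(\<Sum>i. onorm (\<lambda>x. a i (L x)) * norm (y i)) \<le> (\<Sum>i. c * (onorm (a i) * norm (y i)))"
      by (rule suminf_le[OF le sm' summable_mult[OF sm]])
    also have "\<dots> = c * (\<Sum>i. onorm (a i) * norm (y i))" by (rule suminf_mult[OF sm])
    also have "\<dots> \<le> c * s" by (rule mult_left_mono[OF s c])
    finally show ?thesis .
  qed
  ultimately show ?thesis unfolding nuclear_bound_def by blast
qed

text \<open>One representation is chosen for each summand, and the resulting doubly indexed list is
  enumerated as a single sequence. Absolute summability of the list justifies the reordering for
  every \<open>x\<close>.\<close>

lemma nuclear_bound_infsum:
  fixes A :: "'i::countable \<Rightarrow> 'a::banach \<Rightarrow> 'a"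
  assumes J: "complex_banach J" and A: "\<And>i. nuclear_bound J (A i) (s i)"
    and s: "s summable_on UNIV" and B: "\<And>x. ((\<lambda>i. A i x) has_sum B x) UNIV"
  shows "nuclear_bound J B (infsum s UNIV)"
proof -
  have "\<forall>i. \<exists>a y. nuc_rep J (A i) a y \<and> (\<Sum>n. onorm (a n) * norm (y n)) \<le> s i"
    using A by (simp add: nuclear_bound_def)
  then obtain a y where r: "\<And>i. nuc_rep J (A i) (a i) (y i)"
    and sy: "\<And>i. (\<Sum>n. onorm (a i n) * norm (y i n)) \<le> s i" by metis
  define f where "f = (\<lambda>(i, n). onorm (a i n) * norm (y i n))"
  define S where "S i = (\<Sum>n. onorm (a i n) * norm (y i n))" for i
  have ad: "cdual J (a i n)" for i n using r by (simp add: nuc_rep_def)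
  have f0: "0 \<le> f z" for z
    using cdual_bound(2)[OF ad] by (auto simp: f_def case_prod_unfold)
  have fS: "((\<lambda>n. f (i, n)) has_sum S i) UNIV" for i
    using r[of i] f0[of "(i, _)"]
    by (intro sums_nonneg_imp_has_sum) (auto simp: f_def S_def nuc_rep_def)
  have S0: "0 \<le> S i" for i using has_sum_nonneg[OF fS] f0 by auto
  have Ss: "S summable_on UNIV"
    by (rule summable_on_comparison_test[OF s]) (use S0 sy in \<open>auto simp: S_def\<close>)
  have fs: "f summable_on UNIV \<times> UNIV"
    by (rule summable_on_SigmaI[where g = S]) (use fS Ss f0 in auto)
  have "infsum f (UNIV \<times> UNIV) = (\<Sum>\<^sub>\<infinity>i. \<Sum>\<^sub>\<infinity>n. f (i, n))"
    using infsum_Sigma_banach[of f UNIV "\<lambda>_. UNIV"] fs by simp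
  also have "\<dots> = infsum S UNIV" using infsumI[OF fS] by simp
  also have "\<dots> \<le> infsum s UNIV" by (rule infsum_mono[OF Ss s]) (use sy in \<open>auto simp: S_def\<close>)
  finally have fle: "infsum f UNIV \<le> infsum s UNIV" by simp
  define \<phi> where "\<phi> = from_nat_into (UNIV :: ('i \<times> nat) set)"
  \<comment> \<open>The factor \<open>nat\<close> makes the index set infinite even for finite
    \<open>'i\<close>, so an enumeration by a bijection from \<open>nat\<close> exists.\<close>
  have "infinite (UNIV :: ('i \<times> nat) set)" by (simp add: finite_prod)
  then have bij: "bij_betw \<phi> UNIV UNIV" unfolding \<phi>_def by (intro bij_betw_from_nat_into) auto
  define a' where "a' n = a (fst (\<phi> n)) (snd (\<phi> n))" for n
  define y' where "y' n = y (fst (\<phi> n)) (snd (\<phi> n))" for n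
  have f\<phi>: "onorm (a' n) * norm (y' n) = f (\<phi> n)" for n
    by (simp add: a'_def y'_def f_def case_prod_unfold)
  have "((\<lambda>n. f (\<phi> n)) has_sum infsum f UNIV) UNIV"
    using has_sum_reindex_bij_betw[OF bij, of f] fs by simp
  then have sums: "(\<lambda>n. onorm (a' n) * norm (y' n)) sums infsum f UNIV"
    unfolding f\<phi> by (rule has_sum_imp_sums)
  have vs: "(\<lambda>n. cscale J (a' n x) (y' n)) sums B x" for x
  proof -
    define v where "v = (\<lambda>(i, n). cscale J (a i n x) (y i n))"
    have nv: "norm (v z) \<le> f z * norm x" for z
      using nuc_rep_term_bound[OF J r] by (auto simp: v_def f_def case_prod_unfold)
    have av: "v abs_summable_on UNIV \<times> UNIV"
      by (rule summable_on_comparison_test[OF summable_on_cmult_left[OF fs, of "norm x"]]) (use nv in auto)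
    note vsum = abs_summable_summable[OF av]
    have vA: "((\<lambda>n. v (i, n)) has_sum A i x) UNIV" for i
    proof -
      have 1: "(\<lambda>n. v (i, n)) abs_summable_on UNIV"
        by (rule summable_on_comparison_test[OF summable_on_cmult_left[OF has_sum_imp_summable[OF fS[of i]], of "norm x"]])
          (use nv in auto)
      have "(\<lambda>n. v (i, n)) sums infsum (\<lambda>n. v (i, n)) UNIV"
        by (intro has_sum_imp_sums has_sum_infsum abs_summable_summable[OF 1])
      moreover have "(\<lambda>n. v (i, n)) sums A i x" using r[of i] by (simp add: v_def nuc_rep_def)
      ultimately have "infsum (\<lambda>n. v (i, n)) UNIV = A i x" by (rule sums_unique2)
      then show ?thesis using has_sum_infsum[OF abs_summable_summable[OF 1]] by simp
    qed
    have "infsum v UNIV = (\<Sum>\<^sub>\<infinity>i. \<Sum>\<^sub>\<infinity>n. v (i, n))"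
      using infsum_Sigma_banach[of v UNIV "\<lambda>_. UNIV"] vsum by simp
    also have "\<dots> = B x" using infsumI[OF vA] infsumI[OF B[of x]] by simp
    finally have "(v has_sum B x) UNIV" using has_sum_infsum[OF vsum] by simp
    then have "((\<lambda>n. v (\<phi> n)) has_sum B x) UNIV"
      using has_sum_reindex_bij_betw[OF bij, of v] by simp
    moreover have "v (\<phi> n) = cscale J (a' n x) (y' n)" for n
      by (simp add: v_def a'_def y'_def case_prod_unfold)
    ultimately show ?thesis using has_sum_imp_sums by fastforce
  qed
  have "nuc_rep J B a' y'"
    unfolding nuc_rep_def using vs sums ad by (auto simp: a'_def sums_iff)
  then show ?thesis unfolding nuclear_bound_def
    using sums fle by (intro exI[of _ a'] exI[of _ y']) (simp add: sums_iff)
qed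

text \<open>Cutting a representation of the identity after finitely many terms gives a finite rank
  operator \<open>F\<close> with \<open>1 - F\<close> of norm at most 1/2. Then \<open>F\<close> is
  onto, and the vectors \<open>y i\<close> with \<open>i < n\<close> span the space.\<close>

lemma cfindim_of_nuclear_identity:
  fixes J :: "'a::banach \<Rightarrow> 'a"
  assumes J: "complex_banach J" and A: "nuclear_bound J (\<lambda>x. x) s"
  shows "cfindim J"
proof -
  obtain a y where r: "nuc_rep J (\<lambda>x. x) a y" using A by (auto simp: nuclear_bound_def)
  have lJ: "linear J" using J by (simp add: complex_banach_def)
  have la: "linear (a i)" for i using r by (auto simp: nuc_rep_def cdual_def bounded_linear.linear)
  let ?t = "\<lambda>i. onorm (a i) * norm (y i)"
  have sm: "summable ?t" using r by (simp add: nuc_rep_def)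
  have "eventually (\<lambda>n. (\<Sum>i. ?t (i + n)) < 1 / 2) sequentially"
    using suminf_exist_split2[OF sm] by (intro order_tendstoD) auto
  then obtain n where n: "(\<Sum>i. ?t (i + n)) < 1 / 2" by (auto simp: eventually_sequentially)
  define F where "F x = (\<Sum>i<n. cscale J (a i x) (y i))" for x
  have Fadd: "F (u - v) = F u - F v" for u v
    by (simp add: F_def cscale_def linear_diff[OF la] algebra_simps sum_subtractf sum.distrib)
  have E: "norm (x - F x) \<le> 1 / 2 * norm x" for x
  proof -
    have sx: "(\<lambda>i. cscale J (a i x) (y i)) sums x" using r by (simp add: nuc_rep_def)
    have "x - F x = (\<Sum>i. cscale J (a (i + n) x) (y (i + n)))"
      using suminf_minus_initial_segment[OF sums_summable[OF sx], of n] sums_unique[OF sx] by (simp add: F_def)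
    also have "norm \<dots> \<le> (\<Sum>i. ?t (i + n) * norm x)"
      by (rule norm_suminf_le[OF nuc_rep_term_bound[OF J r]])
        (intro summable_mult2 summable_ignore_initial_segment sm)
    also have "\<dots> = (\<Sum>i. ?t (i + n)) * norm x"
      by (intro suminf_mult2[symmetric] summable_ignore_initial_segment sm)
    also have "\<dots> \<le> 1 / 2 * norm x" using n by (intro mult_right_mono) auto
    finally show ?thesis .
  qed
  have "\<exists>c. x = (\<Sum>b\<in>y ` {..<n}. cscale J (c b) b)" for x
  proof -
    \<comment> \<open>The equation \<open>F z = x\<close> rewritten as a fixed point problem for a
      contraction with constant 1/2.\<close>
    have "\<exists>!z. x + (z - F z) = z"
    proof (rule banach_fix_type[of "1 / 2"])
      show "\<forall>u v. dist (x + (u - F u)) (x + (v - F v)) \<le> 1 / 2 * dist u v"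
      proof (intro allI)
        fix u v
        have "x + (u - F u) - (x + (v - F v)) = (u - v) - F (u - v)" by (simp add: Fadd)
        then show "dist (x + (u - F u)) (x + (v - F v)) \<le> 1 / 2 * dist u v"
          using E[of "u - v"] unfolding dist_norm by (simp only:)
      qed
    qed auto
    then obtain z where "x + (z - F z) = z" by blast
    then have "x = F z" by (simp add: algebra_simps)
    \<comment> \<open>The vectors \<open>y i\<close> may repeat, while \<open>cfindim\<close> sums
      over a set; coefficients of equal vectors are therefore collected.\<close>
    also have "\<dots> = (\<Sum>b\<in>y ` {..<n}. \<Sum>i\<in>{i \<in> {..<n}. y i = b}. cscale J (a i z) (y i))"
      unfolding F_def by (rule sum.image_gen) simp
    also have "\<dots> = (\<Sum>b\<in>y ` {..<n}. cscale J (\<Sum>i\<in>{i \<in> {..<n}. y i = b}. a i z) b)"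
      unfolding cscale_sum_left by (intro sum.cong) auto
    finally show ?thesis by (rule exI[of _ "\<lambda>b. \<Sum>i\<in>{i \<in> {..<n}. y i = b}. a i z"])
  qed
  then show ?thesis unfolding cfindim_def by (intro exI[of _ "y ` {..<n}"]) auto
qed

text \<open>Unconditional convergence follows once the error after each finite set is at most the
  remainder of a convergent real series.\<close>

lemma has_sum_of_remainder:
  fixes f :: "'i \<Rightarrow> 'b::real_normed_vector" and h :: "'i \<Rightarrow> real"
  assumes "(h has_sum H) UNIV" "\<And>M. finite M \<Longrightarrow> norm (a - sum f M) \<le> H - sum h M"
  shows "(f has_sum a) UNIV"
proof -
  have "(sum h \<longlongrightarrow> H) (finite_subsets_at_top UNIV)"
    using assms(1) by (simp add: has_sum_def)
  then have "((\<lambda>M. H - sum h M) \<longlongrightarrow> 0) (finite_subsets_at_top UNIV)"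
    using tendsto_diff[OF tendsto_const, of "sum h" H _ H] by simp
  moreover have "eventually (\<lambda>M. norm (sum f M - a) \<le> H - sum h M) (finite_subsets_at_top UNIV)"
    by (rule eventually_finite_subsets_at_top_weakI) (use assms(2) in \<open>simp add: norm_minus_commute\<close>)
  ultimately have "((\<lambda>M. sum f M - a) \<longlongrightarrow> 0) (finite_subsets_at_top UNIV)"
    by (rule Lim_null_comparison[rotated])
  then show ?thesis unfolding has_sum_def by (rule LIM_zero_cancel)
qed

section \<open>Inverse-closedness\<close>

abbreviation single :: "'k \<Rightarrow> 'a::zero \<Rightarrow> 'k \<Rightarrow> 'a" where
  "single l v \<equiv> (\<lambda>i. if i = l then v else 0)"

section \<open>Block matrices of bounded operators\<close>

lemma Bop_add: "Bop J p R \<Longrightarrow> x \<in> lp p \<Longrightarrow> y \<in> lp p \<Longrightarrow> R (\<lambda>k. x k + y k) = (\<lambda>k. R x k + R y k)"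
  by (simp add: Bop_def)

lemma Bop_cscale: "Bop J p R \<Longrightarrow> x \<in> lp p \<Longrightarrow> R (\<lambda>k. cscale J z (x k)) = (\<lambda>k. cscale J z (R x k))"
  by (simp add: Bop_def)

lemma Bop_lp: "Bop J p R \<Longrightarrow> x \<in> lp p \<Longrightarrow> R x \<in> lp p"
  by (simp add: Bop_def)

lemma Bop_diff_scalar:
  fixes R :: "(int ^ 'c::finite \<Rightarrow> 'a::banach) \<Rightarrow> (int ^ 'c \<Rightarrow> 'a)"
  assumes J: "complex_banach J" and p: "1 \<le> p" and R: "Bop J p R"
  shows "Bop J p (\<lambda>x k. R x k - cscale J w (x k))"
proof -
  have lJ: "linear J" using J by (simp add: complex_banach_def)
  obtain C where C: "\<And>x. x \<in> lp p \<Longrightarrow> lpnorm p (R x) \<le> C * lpnorm p x"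
    using R unfolding Bop_def by blast
  have b: "(\<lambda>k. R x k - cscale J w (x k)) \<in> lp p \<and>
      lpnorm p (\<lambda>k. R x k - cscale J w (x k)) \<le> (C + cmod w) * lpnorm p x" if x: "x \<in> lp p" for x
  proof -
    have s: "(\<lambda>k. cscale J w (x k)) \<in> lp p" "lpnorm p (\<lambda>k. cscale J w (x k)) \<le> cmod w * lpnorm p x"
      using lp_scale[OF p x, of "cmod w" "\<lambda>k. cscale J w (x k)"] by (simp_all add: norm_cscale[OF J])
    show ?thesis
      using lp_triangle[OF p Bop_lp[OF R x] s(1) norm_triangle_ineq4] s(2) C[OF x]
      by (auto simp: distrib_right)
  qed
  show ?thesis
    unfolding Bop_def
  proof (intro conjI ballI allI exI[of _ "C + cmod w"])
    fix x y :: "int ^ 'c \<Rightarrow> 'a" assume xy: "x \<in> lp p" "y \<in> lp p"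
    show "(\<lambda>k. R (\<lambda>k. x k + y k) k - cscale J w (x k + y k)) =
        (\<lambda>k. R x k - cscale J w (x k) + (R y k - cscale J w (y k)))"
      by (simp add: Bop_add[OF R xy] cscale_add_right[OF lJ] algebra_simps)
  next
    fix x :: "int ^ 'c \<Rightarrow> 'a" and z assume x: "x \<in> lp p"
    show "(\<lambda>k. R (\<lambda>k. cscale J z (x k)) k - cscale J w (cscale J z (x k))) =
        (\<lambda>k. cscale J z (R x k - cscale J w (x k)))"
      by (simp add: Bop_cscale[OF R x] cscale_diff_right[OF lJ] cscale_cscale[OF J] mult.commute)
  qed (use b in auto)
qed

text \<open>Indexed by row and diagonal, like \<open>b k m\<close> in \<open>locnuc\<close>; the
  column is \<open>k - m\<close>.\<close>

definition mat_entry :: "((int ^ 'c::finite \<Rightarrow> 'a::zero) \<Rightarrow> (int ^ 'c \<Rightarrow> 'a)) \<Rightarrow> int ^ 'c \<Rightarrow> int ^ 'c \<Rightarrow> 'a \<Rightarrow> 'a" where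
  "mat_entry R k m v = R (single (k - m) v) k"

text \<open>Applying a pointwise domination to a one-point family reads off the norm bound
  \<open>\<beta> m\<close> for the entry on diagonal \<open>m\<close>.\<close>

lemma conv_single:
  "conv \<beta> (\<lambda>i. norm (single (k - m) v i)) k = \<beta> m * norm v"
proof -
  have "((\<lambda>n. \<beta> n * norm (single (k - m) v (k - n))) has_sum (\<beta> m * norm v)) UNIV"
    by (rule has_sum_finite_neutralI[where B = "{m}"]) auto
  then show ?thesis unfolding conv_def by (rule infsumI)
qed

lemma mat_entry_clin:
  fixes R :: "(int ^ 'c::finite \<Rightarrow> 'a::banach) \<Rightarrow> (int ^ 'c \<Rightarrow> 'a)"
  assumes J: "complex_banach J" and p: "1 \<le> p" and R: "Bop J p R"
  shows "clin J J (mat_entry R k m)"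
proof (rule clinI)
  fix u v :: 'a
  have "single (k - m) (u + v) = (\<lambda>i. single (k - m) u i + single (k - m) v i)" by auto
  then show "mat_entry R k m (u + v) = mat_entry R k m u + mat_entry R k m v"
    unfolding mat_entry_def by (simp only: Bop_add[OF R lp_single(1)[OF p] lp_single(1)[OF p]])
next
  have lJ: "linear J" using J by (simp add: complex_banach_def)
  fix z v
  have "single (k - m) (cscale J z v) = (\<lambda>i. cscale J z (single (k - m) v i))"
    by (auto simp: cscale_zero_right[OF lJ])
  then show "mat_entry R k m (cscale J z v) = cscale J z (mat_entry R k m v)"
    unfolding mat_entry_def by (simp only: Bop_cscale[OF R lp_single(1)[OF p]])
qed

text \<open>Truncations of \<open>x\<close> need not converge to \<open>x\<close> in norm when
  \<open>p = \<infinity>\<close>. The domination \<open>loc\<close> replaces this: at a fixed site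
  \<open>k\<close> the image of the tail is bounded by the remainder of a convergent series.\<close>

lemma mat_entry_has_sum:
  fixes R :: "(int ^ 'c::finite \<Rightarrow> 'a::banach) \<Rightarrow> (int ^ 'c \<Rightarrow> 'a)"
  assumes p: "1 \<le> p" and R: "Bop J p R" and \<beta>: "\<beta> summable_on UNIV" "\<And>m. 0 \<le> \<beta> m"
    and loc: "\<And>x j. x \<in> lp p \<Longrightarrow> norm (R x j) \<le> conv \<beta> (\<lambda>k. norm (x k)) j"
    and x: "x \<in> lp p"
  shows "((\<lambda>m. mat_entry R k m (x (k - m))) has_sum R x k) UNIV"
proof -
  let ?h = "\<lambda>m. \<beta> m * norm (x (k - m))"
  have hs: "?h summable_on UNIV"
    by (rule conv_bounded_summable[where U = "lpnorm p x"]) (use \<beta> norm_le_lpnorm[OF p x] in auto)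
  \<comment> \<open>Keeps the sites whose diagonal \<open>k - i\<close>, seen from row
    \<open>k\<close>, lies in \<open>M\<close>.\<close>
  define cut where "cut M i = (if k - i \<in> M then x i else 0)" for M i
  have cut: "cut M \<in> lp p" for M by (rule lp_mono(1)[OF p x]) (simp add: cut_def)
  have fin: "(\<Sum>m\<in>M. mat_entry R k m (x (k - m))) = R (cut M) k" if "finite M" for M using that
  proof (induction M)
    case empty
    have "norm (R (cut {}) k) \<le> conv \<beta> (\<lambda>k. norm (cut {} k)) k" by (rule loc[OF cut])
    also have "\<dots> = 0" by (simp add: cut_def conv_def)
    finally show ?case by simp
  next
    case (insert m M)
    have "cut (insert m M) = (\<lambda>i. single (k - m) (x (k - m)) i + cut M i)"
      using insert by (auto simp: cut_def fun_eq_iff algebra_simps)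
    then have "R (cut (insert m M)) k = mat_entry R k m (x (k - m)) + R (cut M) k"
      unfolding mat_entry_def by (simp only: Bop_add[OF R lp_single(1)[OF p] cut])
    then show ?case using insert by simp
  qed
  show ?thesis
  proof (rule has_sum_of_remainder[OF has_sum_infsum[OF hs]])
    fix M :: "(int ^ 'c) set" assume M: "finite M"
    define t where "t i = (if k - i \<in> M then 0 else x i)" for i
    have t: "t \<in> lp p" by (rule lp_mono(1)[OF p x]) (simp add: t_def)
    have "x = (\<lambda>i. cut M i + t i)" by (auto simp: cut_def t_def)
    then have "R x = (\<lambda>k. R (cut M) k + R t k)" using Bop_add[OF R cut[of M] t] by metis
    then have "R x k - (\<Sum>m\<in>M. mat_entry R k m (x (k - m))) = R t k" by (simp add: fin[OF M])
    also have "norm \<dots> \<le> conv \<beta> (\<lambda>i. norm (t i)) k" by (rule loc[OF t])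
    also have "\<dots> = infsum ?h (UNIV - M)"
      unfolding conv_def by (rule infsum_cong_neutral) (auto simp: t_def)
    also have "\<dots> = infsum ?h UNIV - sum ?h M"
      using infsum_Diff[OF hs summable_on_finite[OF M]] M by simp
    finally show "norm (R x k - (\<Sum>m\<in>M. mat_entry R k m (x (k - m)))) \<le> infsum ?h UNIV - sum ?h M" .
  qed
qed

lemma l1g_iff:
  assumes "\<And>m. 0 \<le> \<beta> m"
  shows "l1g g \<beta> \<longleftrightarrow> (\<lambda>m. g m * \<beta> m) summable_on UNIV"
  using assms by (simp add: l1g_def)

lemma locnucI:
  assumes J: "complex_banach J" and T: "Bop J p T"
    and \<beta>: "(\<lambda>m. g m * \<beta> m) summable_on UNIV" "\<And>m. 0 \<le> \<beta> m"
    and b: "\<And>k m. clin J J (b k m)" "\<And>k m. nuclear_bound J (b k m) (\<beta> m)"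
    and s: "\<And>x k. x \<in> lp p \<Longrightarrow> ((\<lambda>m. b k m (x (k - m))) has_sum T x k) UNIV"
  shows "locnuc J p g T"
  unfolding locnuc_def
  using T \<beta> nuclear_of_bound[OF J b] s
  by (intro conjI exI[of _ \<beta>] exI[of _ b]) (auto simp: l1g_iff)

text \<open>Adding the strictly positive summable family \<open>wexp 1\<close> leaves room for a nuclear
  representation, since the infimum defining the nuclear norm need not be attained.\<close>

lemma locnucE:
  assumes g: "weight g" and T: "locnuc J p g T"
  obtains \<beta> b where "(\<lambda>m. g m * \<beta> m) summable_on UNIV" "\<And>m. 0 \<le> \<beta> m"
    "\<And>k m. clin J J (b k m)" "\<And>k m. nuclear_bound J (b k m) (\<beta> m)"
    "\<And>x k. x \<in> lp p \<Longrightarrow> ((\<lambda>m. b k m (x (k - m))) has_sum T x k) UNIV"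
proof -
  obtain \<alpha> b where a: "\<And>m. 0 \<le> \<alpha> m" "l1g g \<alpha>"
    and b: "\<And>k m. nuclear J (b k m)" "\<And>k m. nuclear_norm J (b k m) \<le> \<alpha> m"
    and s: "\<And>x k. x \<in> lp p \<Longrightarrow> ((\<lambda>m. b k m (x (k - m))) has_sum T x k) UNIV"
    using T unfolding locnuc_def by blast
  show ?thesis
  proof (rule that[of "\<lambda>m. \<alpha> m + wexp 1 m" b])
    show "(\<lambda>m. g m * (\<alpha> m + wexp 1 m)) summable_on UNIV"
      unfolding distrib_left using a l1g_iff[of \<alpha> g]
      by (intro summable_on_add weight_wexp_summable[OF g]) auto
    show "0 \<le> \<alpha> m + wexp 1 m" for m using a(1)[of m] wexp_pos[of 1 m] by simp
    show "clin J J (b k m)" for k m using b(1)[of k m] by (simp add: nuclear_def)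
    show "nuclear_bound J (b k m) (\<alpha> m + wexp 1 m)" for k m
      by (rule nuclear_bound_of_nuclear[OF b(1)]) (use b(2)[of k m] wexp_pos[of 1 m] in linarith)
  qed (rule s)
qed

text \<open>The operator \<open>S\<close> is tied to \<open>lam\<close> and \<open>T\<close> on
  \<open>lp p\<close> only, since the values of an operator elsewhere carry no meaning.\<close>

lemma locnuc_inverse:
  fixes J :: "'a::banach \<Rightarrow> 'a" and g :: "int ^ 'c::finite \<Rightarrow> real" and p :: ereal
  assumes J: "complex_banach J" and p: "1 \<le> p" and g: "weight g"
    and T: "locnuc J p g T" and inv: "is_inverse_op J p S R"
    and S: "\<And>x. x \<in> lp p \<Longrightarrow> S x = (\<lambda>k. cscale J lam (x k) + T x k)"
  shows "lam = 0 \<Longrightarrow> cfindim J \<and> locnuc J p g R"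
    and "lam \<noteq> 0 \<Longrightarrow> locnuc J p g (\<lambda>x k. R x k - cscale J (1 / lam) (x k))"
proof -
  have lJ: "linear J" using J by (simp add: complex_banach_def)
  have g1: "1 \<le> g m" and gm: "g (m + n) \<le> g m * g n" for m n using g by (auto simp: weight_def)
  have BS: "Bop J p S" and BR: "Bop J p R" and RS: "\<And>x. x \<in> lp p \<Longrightarrow> R (S x) = x"
    and SR: "\<And>x. x \<in> lp p \<Longrightarrow> S (R x) = x"
    using inv by (auto simp: is_inverse_op_def)
  have BT: "Bop J p T" using T by (simp add: locnuc_def)
  obtain \<beta> b where \<beta>: "(\<lambda>m. g m * \<beta> m) summable_on UNIV" "\<And>m. 0 \<le> \<beta> m"
    and b: "\<And>k m. clin J J (b k m)" "\<And>k m. nuclear_bound J (b k m) (\<beta> m)"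
    and Ts: "\<And>x k. x \<in> lp p \<Longrightarrow> ((\<lambda>m. b k m (x (k - m))) has_sum T x k) UNIV"
    by (rule locnucE[OF g T]) blast
  note \<beta>1 = summable_of_weighted(1)[OF g1 \<beta>]
  have lb: "linear (b k m)" for k m using b(1) by (simp add: clin_def)
  have diag: "((\<lambda>m. if m = 0 then cscale J w (x (k - m)) else 0) has_sum cscale J w (x k)) UNIV"
    for w k and x :: "int ^ 'c \<Rightarrow> 'a"
    by (rule has_sum_finite_neutralI[where B = "{0}"]) auto
  \<comment> \<open>The matrix of \<open>S\<close>: the scalar part sits on the diagonal
    \<open>m = 0\<close> and adds \<open>cmod lam\<close> to the bound there.\<close>
  define s where "s k m v = (if m = 0 then cscale J lam v else 0) + b k m v" for k m v
  define \<beta>S where "\<beta>S m = (if m = 0 then cmod lam else 0) + \<beta> m" for m :: "int ^ 'c"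
  obtain K0 where K0: "\<And>x. x \<in> lp p \<Longrightarrow> lpnorm p (R x) \<le> K0 * lpnorm p x"
    using BR unfolding Bop_def by blast
  obtain \<beta>' where \<beta>': "(\<lambda>m. g m * \<beta>' m) summable_on UNIV" "\<And>m. 0 \<le> \<beta>' m"
    and loc: "\<And>x j. x \<in> lp p \<Longrightarrow> norm (R x j) \<le> conv \<beta>' (\<lambda>k. norm (x k)) j"
  proof (rule inverse_localized[OF p g, of \<beta>S s S R K0])
    have "(\<lambda>m. if m = 0 then g m * cmod lam else 0) summable_on UNIV"
      by (rule finite_nonzero_values_imp_summable_on) simp
    from summable_on_add[OF this \<beta>(1)]
    show "(\<lambda>m. g m * \<beta>S m) summable_on UNIV"
      by (rule summable_on_cong[THEN iffD1, rotated]) (simp add: \<beta>S_def distrib_left)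
    show "0 \<le> \<beta>S m" for m using \<beta>(2)[of m] by (simp add: \<beta>S_def)
    show "norm (s k m v) \<le> \<beta>S m * norm v" for k m v
      using nuclear_bound_norm[OF J b(2)[of k m], of v]
        norm_triangle_ineq[of "if m = 0 then cscale J lam v else 0" "b k m v"]
      by (auto simp: s_def \<beta>S_def distrib_right norm_cscale[OF J])
    show "s k m (r *\<^sub>R v) = r *\<^sub>R s k m v" for k m r v
      by (simp add: s_def linear_scale[OF lb] cscale_def linear_scale[OF lJ] algebra_simps)
    show "((\<lambda>m. s k m (x (k - m))) has_sum S x k) UNIV" if "x \<in> lp p" for x k
      unfolding S[OF that] s_def by (intro has_sum_add diag Ts that)
  qed (use RS SR K0 Bop_lp[OF BS] Bop_lp[OF BR] in blast)+
  note \<beta>'1 = summable_of_weighted(1)[OF g1 \<beta>']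
  let ?r = "mat_entry R"
  have r: "clin J J (?r k m)" for k m by (rule mat_entry_clin[OF J p BR])
  have rn: "norm (?r k m v) \<le> \<beta>' m * norm v" for k m v
    using loc[OF lp_single(1)[OF p, of "k - m" v], of k] unfolding conv_single mat_entry_def .
  have rs: "((\<lambda>m. ?r k m (x (k - m))) has_sum R x k) UNIV" if "x \<in> lp p" for x k
    by (rule mat_entry_has_sum[OF p BR \<beta>'1 \<beta>'(2) loc that])
  show "cfindim J \<and> locnuc J p g R" if lam: "lam = 0"
  proof -
    \<comment> \<open>The terms of the entry of \<open>T R\<close> at row and column 0:
      \<open>b 0 m\<close> reads site \<open>- m\<close>, and the entry of \<open>R\<close> from
      column 0 to row \<open>- m\<close> lies on diagonal \<open>- m\<close>.\<close>
    have nb: "nuclear_bound J (\<lambda>v. b 0 m (?r (- m) (- m) v)) (\<beta>' (- m) * \<beta> m)" for m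
      by (rule nuclear_bound_compose_right[OF J b(2) r rn \<beta>'(2)])
    have sm: "(\<lambda>m. \<beta>' (- m) * \<beta> m) summable_on UNIV"
      using conv_summable(1)[OF \<beta>1 \<beta>'1 \<beta>(2) \<beta>'(2), of 0] by (simp add: mult.commute)
    have hs: "((\<lambda>m. b 0 m (?r (- m) (- m) v)) has_sum v) UNIV" for v
    proof -
      have x: "single 0 v \<in> lp p" by (rule lp_single(1)[OF p])
      have "T (R (single 0 v)) = single 0 v"
        using SR[OF x] S[OF Bop_lp[OF BR x]] by (simp add: lam cscale_def)
      then show ?thesis
        using Ts[OF Bop_lp[OF BR x], of 0] by (simp add: mat_entry_def)
    qed
    obtain s0 where id: "nuclear_bound J (\<lambda>v. v) s0"
      using nuclear_bound_infsum[OF J nb sm hs] by blast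
    have "locnuc J p g R"
    proof (rule locnucI[OF J BR _ _ r _ rs])
      \<comment> \<open>Each entry of \<open>R\<close> is its own composition with the identity,
        which has just been shown to be nuclear.\<close>
      show "nuclear_bound J (?r k m) (\<beta>' m * s0)" for k m
        by (rule nuclear_bound_compose_left[OF J id r rn \<beta>'(2)])
      show "(\<lambda>m. g m * (\<beta>' m * s0)) summable_on UNIV"
        using summable_on_cmult_left[OF \<beta>'(1), of s0] by (simp add: mult.assoc)
      show "0 \<le> \<beta>' m * s0" for m using \<beta>'(2) nuclear_bound_nonneg[OF id] by simp
    qed
    then show ?thesis using cfindim_of_nuclear_identity[OF J id] by blast
  qed
  show "locnuc J p g (\<lambda>x k. R x k - cscale J (1 / lam) (x k))" if lam: "lam \<noteq> 0"
  proof -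
    define t where "t k m v = ?r k m v - (if m = 0 then cscale J (1 / lam) v else 0)" for k m v
    \<comment> \<open>The matrix of \<open>R T\<close>. The product formula below, with diagonals
      \<open>n\<close> and \<open>m - n\<close> adding up to \<open>m\<close>, yields the nuclear
      bound \<open>conv \<beta>' \<beta> m\<close>.\<close>
    define Q where "Q k m v = R (T (single (k - m) v)) k" for k m v
    have Qs: "((\<lambda>n. ?r k n (b (k - n) (m - n) v)) has_sum Q k m v) UNIV" for k m v
    proof -
      have x: "single (k - m) v \<in> lp p" by (rule lp_single(1)[OF p])
      have "T (single (k - m) v) i = b i (i - (k - m)) v" for i
      proof -
        have "((\<lambda>n. b i n (single (k - m) v (i - n))) has_sum b i (i - (k - m)) v) UNIV"
          by (rule has_sum_finite_neutralI[where B = "{i - (k - m)}"])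
            (auto simp: linear_0[OF lb] algebra_simps)
        then show ?thesis using Ts[OF x, of i] has_sum_unique by blast
      qed
      moreover have "k - n - (k - m) = m - n" for n by simp
      ultimately show ?thesis using rs[OF Bop_lp[OF BT x], of k] by (simp add: Q_def)
    qed
    have Qb: "nuclear_bound J (Q k m) (conv \<beta>' \<beta> m)" for k m
      unfolding conv_def
      by (rule nuclear_bound_infsum[OF J _ _ Qs])
        (intro nuclear_bound_compose_left[OF J b(2) r rn \<beta>'(2)] conv_summable \<beta>'1 \<beta>1 \<beta>'(2) \<beta>(2))+
    \<comment> \<open>The identity \<open>R S = 1\<close> reads \<open>lam R + R T = 1\<close>, so
      \<open>R - 1/lam = - (1/lam) R T\<close>, here entry by entry.\<close>
    have tQ: "t k m v = cscale J (- 1 / lam) (Q k m v)" for k m v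
    proof -
      have x: "single (k - m) v \<in> lp p" by (rule lp_single(1)[OF p])
      have sx: "(\<lambda>i. cscale J lam (single (k - m) v i)) \<in> lp p"
        by (rule lp_scale(1)[OF p x, of "cmod lam"]) (auto simp: norm_cscale[OF J])
      have "single (k - m) v k = R (S (single (k - m) v)) k" by (simp only: RS[OF x])
      also have "\<dots> = cscale J lam (?r k m v) + Q k m v"
        unfolding S[OF x] Bop_add[OF BR sx Bop_lp[OF BT x]] Bop_cscale[OF BR x]
        by (simp add: mat_entry_def Q_def)
      finally have e: "Q k m v = (if m = 0 then v else 0) - cscale J lam (?r k m v)" by (auto simp: algebra_simps)
      have "cscale J (- 1 / lam) (Q k m v) =
          cscale J (- 1 / lam) (if m = 0 then v else 0) - cscale J (- 1) (?r k m v)"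
        unfolding e cscale_diff_right[OF lJ] cscale_cscale[OF J] using lam by simp
      also have "\<dots> = t k m v"
        by (auto simp: t_def cscale_def linear_0[OF lJ])
      finally show ?thesis by simp
    qed
    have tb: "nuclear_bound J (t k m) (cmod (- 1 / lam) * conv \<beta>' \<beta> m)" for k m
      unfolding tQ[abs_def]
      by (rule nuclear_bound_compose_left[OF J Qb clin_cscale_op[OF J]]) (auto simp: norm_cscale[OF J])
    have tl: "clin J J (t k m)" for k m
    proof (rule clinI)
      show "t k m (u + v) = t k m u + t k m v" for u v
        using r[of k m] by (simp add: t_def clin_def linear_add cscale_add_right[OF lJ])
      show "t k m (cscale J z v) = cscale J z (t k m v)" for z v
        by (simp add: t_def cscale_diff_right[OF lJ] clin_cscale[OF r] cscale_cscale[OF J] cscale_zero_right[OF lJ] mult.commute)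
    qed
    show ?thesis
    proof (rule locnucI[OF J Bop_diff_scalar[OF J p BR] _ _ tl tb])
      have "(\<lambda>m. cmod (- 1 / lam) * (g m * conv \<beta>' \<beta> m)) summable_on UNIV"
        by (intro summable_on_cmult_right conv_weighted(1) g1 gm \<beta>' \<beta>)
      then show "(\<lambda>m. g m * (cmod (- 1 / lam) * conv \<beta>' \<beta> m)) summable_on UNIV"
        by (simp add: ac_simps)
      show "0 \<le> cmod (- 1 / lam) * conv \<beta>' \<beta> m" for m
        by (intro mult_nonneg_nonneg norm_ge_zero conv_nonneg \<beta>'(2) \<beta>(2))
      show "((\<lambda>m. t k m (x (k - m))) has_sum R x k - cscale J (1 / lam) (x k)) UNIV"
        if "x \<in> lp p" for x k
        unfolding t_def by (intro has_sum_diff rs that diag)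
    qed
  qed
qed

theorem mainTheorem1:
  fixes J :: "'a::banach \<Rightarrow> 'a"
    and g :: "int ^ 'c::finite \<Rightarrow> real"
    and p :: ereal
  assumes "complex_banach J"
    and "1 \<le> p"
    and "weight g"
  shows "(\<forall>S R. locnuc_tilde J p g S \<and> is_inverse_op J p S R \<longrightarrow> locnuc_tilde J p g R) \<and>
         (\<not> cfindim J \<longrightarrow>
            (\<forall>lam T R. locnuc J p g T \<and>
               is_inverse_op J p (\<lambda>x k. cscale J lam (x k) + T x k) R \<longrightarrow>
               lam \<noteq> 0 \<and>
               (\<exists>T1. locnuc J p g T1 \<and>
                  (\<forall>x\<in>lp p. R x = (\<lambda>k. cscale J (1 / lam) (x k) + T1 x k)))))"
proof -
  have inf: "lam \<noteq> 0 \<and> (\<exists>T1. locnuc J p g T1 \<and>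
      (\<forall>x\<in>lp p. R x = (\<lambda>k. cscale J (1 / lam) (x k) + T1 x k)))"
    if "\<not> cfindim J" "locnuc J p g T" "is_inverse_op J p S R"
      "\<And>x. x \<in> lp p \<Longrightarrow> S x = (\<lambda>k. cscale J lam (x k) + T x k)" for lam S T R
  proof -
    have "lam \<noteq> 0" using locnuc_inverse(1)[OF assms that(2-4)] that(1) by blast
    then show ?thesis
      using locnuc_inverse(2)[OF assms that(2-4)]
      by (intro conjI exI[of _ "\<lambda>x k. R x k - cscale J (1 / lam) (x k)"]) auto
  qed
  show ?thesis
  proof (intro conjI allI impI; (elim conjE)?)
    fix S R assume S: "locnuc_tilde J p g S" and R: "is_inverse_op J p S R"
    show "locnuc_tilde J p g R"
    proof (cases "cfindim J")
      case True
      then have "locnuc J p g R"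
        \<comment> \<open>For finite-dimensional X there is no scalar part: the operator itself
          plays the role of \<open>T\<close>, with \<open>lam = 0\<close>.\<close>
        using locnuc_inverse(1)[OF assms _ R, of S 0] S by (simp add: locnuc_tilde_def cscale_def)
      then show ?thesis using True by (simp add: locnuc_tilde_def)
    next
      case False
      then show ?thesis using S inf[OF False _ R] unfolding locnuc_tilde_def by (simp; blast)
    qed
  next
    fix lam T R
    assume "\<not> cfindim J" "locnuc J p g T" "is_inverse_op J p (\<lambda>x k. cscale J lam (x k) + T x k) R"
    from inf[OF this refl] show "lam \<noteq> 0"
      "\<exists>T1. locnuc J p g T1 \<and> (\<forall>x\<in>lp p. R x = (\<lambda>k. cscale J (1 / lam) (x k) + T1 x k))" by auto
  qed
qed

end
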